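(* Let $\tau$ be a Euclidean triangle and let $G_\tau$ be its triangle group, with reflections $r_1,r_2,r_3$ and translation subgroup $T_\tau$ (see context). If $\tau$ is typical, then $T_\tau$ is the normal closure in $G_\tau$ of the translation $t_1=(r_1r_2r_3)^2$. Moreover, if $\tau$ is generic, then $T_\tau$ is a free abelian group having as a basis the conjugacy class $C(t_1)=\{g^{-1}t_1g \mid g\in G_\tau\}$ of $t_1$ in $G_\tau$.
   Context: A Euclidean triangle $\tau=A_1A_2A_3$ has edges $e_i=A_jA_k$ of length $\ell_i>0$ and interior angles $\alpha_i>0$ at $A_i$, where $\{i,j,k\}=\{1,2,3\}$. The triangle $\tau$ is generic if for some real $k>0$ the numbers $k\ell_1,k\ell_2,k\ell_3$ are algebraically independent over $\mathbb{Q}$. It is typical if $\alpha_1,\alpha_2,\alpha_3$ are linearly independent over $\mathbb{Q}$. Let $r_i$ be the reflection of the Euclidean plane across the line containing $e_i$, and let $G_\tau=\langle r_1,r_2,r_3\rangle$ be the subgroup of the Euclidean isometry group $\mathrm{E}(2)$ they generate (the triangle group). Isometries act on the right and products are composed left to right: $(x)gh=((x)g)h$. $T_\tau$ is the subgroup of all translations in $G_\tau$. *)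

theory Defs
  imports "HOL-Analysis.Analysis" "HOL-Algebra.Algebra"
begin

text \<open>The Euclidean plane is modelled by the complex numbers.  Isometries act on the
right and are composed left to right: the product g h is the map x \<mapsto> h (g x).\<close>

definition E2 :: "(complex \<Rightarrow> complex) monoid" where
  "E2 = \<lparr> carrier = {f. surj f \<and> (\<forall>x y. dist (f x) (f y) = dist x y)},
          mult = (\<lambda>g h. h \<circ> g), one = id \<rparr>"

definition reflection_line :: "complex \<Rightarrow> complex \<Rightarrow> complex \<Rightarrow> complex" where
  "reflection_line P Q z = P + ((Q - P) / cnj (Q - P)) * cnj (z - P)"

definition vertex_angle :: "complex \<Rightarrow> complex \<Rightarrow> complex \<Rightarrow> real" where
  "vertex_angle A B C = arccos (((B - A) \<bullet> (C - A)) / (norm (B - A) * norm (C - A)))"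

definition nondegenerate_triangle :: "complex \<Rightarrow> complex \<Rightarrow> complex \<Rightarrow> bool" where
  "nondegenerate_triangle A1 A2 A3 \<longleftrightarrow> \<not> collinear {A1, A2, A3}"

definition r1 where "r1 A1 A2 A3 = reflection_line A2 A3"
definition r2 where "r2 A1 A2 A3 = reflection_line A3 A1"
definition r3 where "r3 A1 A2 A3 = reflection_line A1 A2"

definition len1 where "len1 A1 A2 A3 = dist A2 A3"
definition len2 where "len2 A1 A2 A3 = dist A3 A1"
definition len3 where "len3 A1 A2 A3 = dist A1 A2"
definition ang1 where "ang1 A1 A2 A3 = vertex_angle A1 A2 A3"
definition ang2 where "ang2 A1 A2 A3 = vertex_angle A2 A3 A1"
definition ang3 where "ang3 A1 A2 A3 = vertex_angle A3 A1 A2"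

text \<open>Algebraic independence of three reals over Q: no nonzero polynomial in three
variables with rational coefficients vanishes at (x,y,z).  A polynomial is given by
its finitely supported coefficient function on exponent triples.\<close>
definition alg_indep3 :: "real \<Rightarrow> real \<Rightarrow> real \<Rightarrow> bool" where
  "alg_indep3 x y z \<longleftrightarrow>
     (\<forall>c :: nat \<times> nat \<times> nat \<Rightarrow> real.
        finite {e. c e \<noteq> 0} \<longrightarrow> (\<forall>e. c e \<in> \<rat>) \<longrightarrow>
        (\<Sum>(a, b, d)\<in>{e. c e \<noteq> 0}. c (a, b, d) * x ^ a * y ^ b * z ^ d) = 0 \<longrightarrow>
        (\<forall>e. c e = 0))"

definition generic_triangle :: "complex \<Rightarrow> complex \<Rightarrow> complex \<Rightarrow> bool" where
  "generic_triangle A1 A2 A3 \<longleftrightarrow>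
     (\<exists>k>0. alg_indep3 (k * len1 A1 A2 A3) (k * len2 A1 A2 A3) (k * len3 A1 A2 A3))"

definition typical_triangle :: "complex \<Rightarrow> complex \<Rightarrow> complex \<Rightarrow> bool" where
  "typical_triangle A1 A2 A3 \<longleftrightarrow>
     (\<forall>q1 q2 q3. q1 \<in> \<rat> \<longrightarrow> q2 \<in> \<rat> \<longrightarrow> q3 \<in> \<rat> \<longrightarrow>
        q1 * ang1 A1 A2 A3 + q2 * ang2 A1 A2 A3 + q3 * ang3 A1 A2 A3 = 0 \<longrightarrow>
        q1 = 0 \<and> q2 = 0 \<and> q3 = 0)"

definition triangle_group :: "complex \<Rightarrow> complex \<Rightarrow> complex \<Rightarrow> (complex \<Rightarrow> complex) set" where
  "triangle_group A1 A2 A3 = generate E2 {r1 A1 A2 A3, r2 A1 A2 A3, r3 A1 A2 A3}"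

definition is_translation :: "(complex \<Rightarrow> complex) \<Rightarrow> bool" where
  "is_translation f \<longleftrightarrow> (\<exists>c. f = (\<lambda>z. z + c))"

definition translation_subgroup :: "complex \<Rightarrow> complex \<Rightarrow> complex \<Rightarrow> (complex \<Rightarrow> complex) set" where
  "translation_subgroup A1 A2 A3 = {g \<in> triangle_group A1 A2 A3. is_translation g}"

definition t1 :: "complex \<Rightarrow> complex \<Rightarrow> complex \<Rightarrow> complex \<Rightarrow> complex" where
  "t1 A1 A2 A3 = (r1 A1 A2 A3 \<otimes>\<^bsub>E2\<^esub> r2 A1 A2 A3 \<otimes>\<^bsub>E2\<^esub> r3 A1 A2 A3) [^]\<^bsub>E2\<^esub> (2::nat)"

definition conj_class :: "(complex \<Rightarrow> complex) set \<Rightarrow> (complex \<Rightarrow> complex) \<Rightarrow> (complex \<Rightarrow> complex) set" where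
  "conj_class H x = {inv\<^bsub>E2\<^esub> g \<otimes>\<^bsub>E2\<^esub> x \<otimes>\<^bsub>E2\<^esub> g | g. g \<in> H}"

definition normal_closure :: "(complex \<Rightarrow> complex) set \<Rightarrow> (complex \<Rightarrow> complex) \<Rightarrow> (complex \<Rightarrow> complex) set" where
  "normal_closure H x = generate E2 (conj_class H x)"

definition free_abelian_basis :: "('a, 'b) monoid_scheme \<Rightarrow> 'a set \<Rightarrow> 'a set \<Rightarrow> bool" where
  "free_abelian_basis G H B \<longleftrightarrow>
     comm_group (G\<lparr>carrier := H\<rparr>) \<and> B \<subseteq> H \<and>
     (\<forall>x\<in>H. \<exists>!n :: 'a \<Rightarrow> int.
        finite {b. n b \<noteq> 0} \<and> {b. n b \<noteq> 0} \<subseteq> B \<and>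
        x = finprod G (\<lambda>b. b [^]\<^bsub>G\<^esub> n b) {b. n b \<noteq> 0})"

end

theory Submission
  imports Defs
begin

text \<open>
  Place the triangle at \<open>0, 1, w\<close> and put \<open>x = w / cnj w\<close>, \<open>y = cnj (1 - w) / (1 - w)\<close>. The reflections
  are \<open>cnj z\<close>, \<open>x * cnj z\<close> and \<open>cnj z / y + 1 - 1 / y\<close>, and \<open>t1\<close> is the translation by
  \<open>v = (1 - 1 / y) * (1 / x - 1)\<close>. Its conjugates are exactly the translations by \<open>x^a * y^b * v\<close>; let \<open>M\<close>
  be their integral span. Since \<open>(1 - x^a) * (1 - y^b)\<close> lies in \<open>M\<close>, every group element is
  \<open>z \<mapsto> x^a * y^b * z + (1 - y^b) + m\<close> or the same with \<open>cnj z\<close>, with \<open>m \<in> M\<close>. If \<open>x\<close> and \<open>y\<close> are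
  multiplicatively independent, as they are for a typical triangle because the angles sum to an odd
  multiple of \<open>\<pi>\<close>, a translation must have \<open>a = b = 0\<close>, so it lies in \<open>M\<close>.

  For a generic triangle, a Laurent relation \<open>P(x, y) = 0\<close> becomes, after clearing denominators,
  \<open>p + \<i> * \<delta> * q = 0\<close> with \<open>p, q\<close> rational polynomials in the side lengths and \<open>\<delta>\<close> four times the area.
  Algebraic independence forces \<open>p = q = 0\<close> identically, so \<open>P\<close> vanishes for every triangle, in particular
  at all \<open>(cis s)^2, (cis t)^2\<close> with \<open>0 < s, t < \<pi> / 2\<close>, whence \<open>P = 0\<close>.
\<close>

section \<open>Laurent relations and algebraic independence\<close>

inductive rat_poly_fun :: "(real \<Rightarrow> real \<Rightarrow> real \<Rightarrow> real) \<Rightarrow> bool" where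
  const: "q \<in> \<rat> \<Longrightarrow> rat_poly_fun (\<lambda>a b c. q)"
| var1: "rat_poly_fun (\<lambda>a b c. a)"
| var2: "rat_poly_fun (\<lambda>a b c. b)"
| var3: "rat_poly_fun (\<lambda>a b c. c)"
| add: "rat_poly_fun f \<Longrightarrow> rat_poly_fun g \<Longrightarrow> rat_poly_fun (\<lambda>a b c. f a b c + g a b c)"
| mult: "rat_poly_fun f \<Longrightarrow> rat_poly_fun g \<Longrightarrow> rat_poly_fun (\<lambda>a b c. f a b c * g a b c)"

definition term_val :: "real \<times> nat \<times> nat \<times> nat \<Rightarrow> real \<Rightarrow> real \<Rightarrow> real \<Rightarrow> real" where
  "term_val t a b c = (case t of (q, i, j, k) \<Rightarrow> q * a ^ i * b ^ j * c ^ k)"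

text \<open>Exponents may repeat in the list, so sums and products of lists need no bookkeeping;
  like terms are collected only in \<open>terms_val_collect\<close>.\<close>

definition terms_val :: "(real \<times> nat \<times> nat \<times> nat) list \<Rightarrow> real \<Rightarrow> real \<Rightarrow> real \<Rightarrow> real" where
  "terms_val L a b c = (\<Sum>t\<leftarrow>L. term_val t a b c)"

lemma rat_poly_fun_terms:
  assumes "rat_poly_fun f"
  shows "\<exists>L. fst ` set L \<subseteq> \<rat> \<and> f = terms_val L"
  using assms
proof induction
  case (const q)
  then show ?case
    by (intro exI[of _ "[(q, 0, 0, 0)]"]) (auto simp: terms_val_def term_val_def fun_eq_iff)
next
  case var1
  show ?case
    by (intro exI[of _ "[(1, 1, 0, 0)]"]) (auto simp: terms_val_def term_val_def fun_eq_iff)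
next
  case var2
  show ?case
    by (intro exI[of _ "[(1, 0, 1, 0)]"]) (auto simp: terms_val_def term_val_def fun_eq_iff)
next
  case var3
  show ?case
    by (intro exI[of _ "[(1, 0, 0, 1)]"]) (auto simp: terms_val_def term_val_def fun_eq_iff)
next
  case (add f g)
  then obtain L K where "fst ` set L \<subseteq> \<rat>" "f = terms_val L" "fst ` set K \<subseteq> \<rat>" "g = terms_val K"
    by blast
  then show ?case
    by (intro exI[of _ "L @ K"]) (auto simp: terms_val_def fun_eq_iff)
next
  case (mult f g)
  then obtain L K where L: "fst ` set L \<subseteq> \<rat>" "f = terms_val L"
    and K: "fst ` set K \<subseteq> \<rat>" "g = terms_val K"
    by blast
  \<comment> \<open>Product of two monomials; two lists are multiplied by forming all pairwise
    products.\<close>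
  define mul where "mul = (\<lambda>s t :: real \<times> nat \<times> nat \<times> nat. case (s, t) of
    ((q, i, j, k), (q', i', j', k')) \<Rightarrow> (q * q', i + i', j + j', k + k'))"
  have mul: "term_val (mul s t) a b c = term_val s a b c * term_val t a b c" for s t a b c
    by (auto simp: mul_def term_val_def power_add split: prod.splits)
  have "terms_val (concat (map (\<lambda>s. map (mul s) K) L)) a b c = terms_val L a b c * terms_val K a b c"
    for a b c
  proof (induction L)
    case (Cons s L)
    have "terms_val (map (mul s) K) a b c = term_val s a b c * terms_val K a b c"
      by (simp add: terms_val_def mul sum_list_const_mult o_def)
    with Cons show ?case by (simp add: terms_val_def algebra_simps)
  qed (simp add: terms_val_def)
  moreover have "fst ` set (concat (map (\<lambda>s. map (mul s) K) L)) \<subseteq> \<rat>"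
    using L(1) K(1) by (fastforce simp: mul_def)
  ultimately show ?case using L(2) K(2) by (metis (no_types, lifting) ext)
qed

lemma terms_val_collect:
  assumes "finite E" "snd ` set L \<subseteq> E"
  shows "(\<Sum>(i, j, k)\<in>E. (\<Sum>t\<leftarrow>L. if snd t = (i, j, k) then fst t else 0) * a ^ i * b ^ j * c ^ k)
    = terms_val L a b c"
  using assms(2)
proof (induction L)
  case (Cons t L)
  have *: "(\<Sum>e\<in>E. (if snd t = e then fst t else 0) * (case e of (i, j, k) \<Rightarrow> a ^ i * b ^ j * c ^ k))
    = term_val t a b c"
  proof -
    have "(\<Sum>e\<in>E. (if snd t = e then fst t else 0) * (case e of (i, j, k) \<Rightarrow> a ^ i * b ^ j * c ^ k))
      = (\<Sum>e\<in>E. if snd t = e then fst t * (case snd t of (i, j, k) \<Rightarrow> a ^ i * b ^ j * c ^ k) else 0)"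
      by (intro sum.cong) auto
    also have "\<dots> = fst t * (case snd t of (i, j, k) \<Rightarrow> a ^ i * b ^ j * c ^ k)"
      using assms(1) Cons.prems by simp
    finally show ?thesis by (simp add: term_val_def split: prod.splits)
  qed
  show ?case
    using Cons * by (simp add: terms_val_def case_prod_unfold algebra_simps sum.distrib)
qed (simp add: terms_val_def)

text \<open>Once like terms are collected, independence kills every coefficient, so a zero at one
  independent point makes \<open>f\<close> vanish identically. This carries relations from one
  triangle to all others.\<close>

lemma rat_poly_fun_vanish:
  assumes "rat_poly_fun f" "alg_indep3 a b c" "f a b c = 0"
  shows "f a' b' c' = 0"
proof -
  obtain L where L: "fst ` set L \<subseteq> \<rat>" "f = terms_val L"
    using rat_poly_fun_terms[OF assms(1)] by blast
  define C where "C e = (\<Sum>t\<leftarrow>L. if snd t = e then fst t else 0)" for e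
  have nz: "C e = 0" if "e \<notin> snd ` set L" for e
    using that unfolding C_def by (induction L) auto
  then have supp: "{e. C e \<noteq> 0} \<subseteq> snd ` set L" by blast
  have rat: "C e \<in> \<rat>" for e
    using L(1) unfolding C_def by (induction L) auto
  have "(\<Sum>(i, j, k)\<in>{e. C e \<noteq> 0}. C (i, j, k) * x ^ i * y ^ j * z ^ k)
      = (\<Sum>(i, j, k)\<in>snd ` set L. C (i, j, k) * x ^ i * y ^ j * z ^ k)" for x y z
    by (intro sum.mono_neutral_left supp) auto
  also have "\<dots> x y z = f x y z" for x y z
    using terms_val_collect[of "snd ` set L" L x y z] by (simp add: L(2) C_def)
  finally have sum: "(\<Sum>(i, j, k)\<in>{e. C e \<noteq> 0}. C (i, j, k) * x ^ i * y ^ j * z ^ k) = f x y z" for x y z .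
  have "finite {e. C e \<noteq> 0}" using supp finite_subset by blast
  then have "C e = 0" for e
    by (rule assms(2)[unfolded alg_indep3_def, rule_format]) (simp_all only: rat sum assms(3))
  with sum[of a' b' c'] show ?thesis by simp
qed

section \<open>Heron's polynomial (16 times the squared area) and the ring it defines\<close>

definition heron :: "real \<Rightarrow> real \<Rightarrow> real \<Rightarrow> real" where
  "heron a b c = 2 * (a\<^sup>2 * b\<^sup>2 + b\<^sup>2 * c\<^sup>2 + c\<^sup>2 * a\<^sup>2) - (a ^ 4 + b ^ 4 + c ^ 4)"

text \<open>Membership in the ring \<open>\<rat>[a, b, c][\<i> \<delta>]\<close>, where \<open>\<delta>\<close> is four times the signed area.\<close>

definition heron_fun :: "(real \<Rightarrow> real \<Rightarrow> real \<Rightarrow> real \<Rightarrow> complex) \<Rightarrow> bool" where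
  "heron_fun F \<longleftrightarrow> (\<exists>p q. rat_poly_fun p \<and> rat_poly_fun q \<and>
     (\<forall>a b c d. d\<^sup>2 = heron a b c \<longrightarrow> F a b c d = Complex (p a b c) (d * q a b c)))"

lemma rat_poly_fun_heron: "rat_poly_fun heron"
proof -
  note ri = rat_poly_fun.intros
  have "rat_poly_fun (\<lambda>a b c. 2 * (a * a * (b * b) + b * b * (c * c) + c * c * (a * a)) + (-1) * (a * a * (a * a) + b * b * (b * b) + c * c * (c * c)))"
    by (intro ri) auto
  also have "(\<lambda>a b c :: real. 2 * (a * a * (b * b) + b * b * (c * c) + c * c * (a * a)) + (-1) * (a * a * (a * a) + b * b * (b * b) + c * c * (c * c))) = heron"
    by (simp add: heron_def fun_eq_iff power2_eq_square power4_eq_xxxx)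
  finally show ?thesis .
qed

lemma heron_fun_of_rat_poly:
  assumes "rat_poly_fun p"
  shows "heron_fun (\<lambda>a b c d. complex_of_real (p a b c))"
  unfolding heron_fun_def
  using assms rat_poly_fun.const[of 0]
  by (intro exI[of _ p] exI[of _ "\<lambda>a b c. 0"]) (auto simp: complex_of_real_def)

lemma heron_fun_add:
  assumes "heron_fun F" "heron_fun G"
  shows "heron_fun (\<lambda>a b c d. F a b c d + G a b c d)"
proof -
  obtain p q p' q' where
    pq: "rat_poly_fun p" "rat_poly_fun q" "\<And>a b c d. d\<^sup>2 = heron a b c \<Longrightarrow> F a b c d = Complex (p a b c) (d * q a b c)"
    and pq': "rat_poly_fun p'" "rat_poly_fun q'" "\<And>a b c d. d\<^sup>2 = heron a b c \<Longrightarrow> G a b c d = Complex (p' a b c) (d * q' a b c)"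
    using assms unfolding heron_fun_def by blast
  show ?thesis unfolding heron_fun_def
    by (rule exI[of _ "\<lambda>a b c. p a b c + p' a b c"], rule exI[of _ "\<lambda>a b c. q a b c + q' a b c"])
      (auto simp: pq pq' algebra_simps complex_eq_iff intro: rat_poly_fun.add)
qed

text \<open>The square of \<open>\<i> * d\<close> is minus Heron's polynomial, hence again a
  rational polynomial, so products keep the two-component shape.\<close>

lemma heron_fun_mult:
  assumes "heron_fun F" "heron_fun G"
  shows "heron_fun (\<lambda>a b c d. F a b c d * G a b c d)"
proof -
  obtain p q p' q' where
    pq: "rat_poly_fun p" "rat_poly_fun q" "\<And>a b c d. d\<^sup>2 = heron a b c \<Longrightarrow> F a b c d = Complex (p a b c) (d * q a b c)"
    and pq': "rat_poly_fun p'" "rat_poly_fun q'" "\<And>a b c d. d\<^sup>2 = heron a b c \<Longrightarrow> G a b c d = Complex (p' a b c) (d * q' a b c)"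
    using assms unfolding heron_fun_def by blast
  show ?thesis unfolding heron_fun_def
  proof (intro exI conjI allI impI)
    show "rat_poly_fun (\<lambda>a b c. p a b c * p' a b c + (-1) * (heron a b c * (q a b c * q' a b c)))"
      by (intro rat_poly_fun.intros pq pq' rat_poly_fun_heron) auto
    show "rat_poly_fun (\<lambda>a b c. p a b c * q' a b c + q a b c * p' a b c)"
      by (intro rat_poly_fun.intros pq pq')
    fix a b c d :: real
    assume d: "d\<^sup>2 = heron a b c"
    show "F a b c d * G a b c d = Complex (p a b c * p' a b c + (-1) * (heron a b c * (q a b c * q' a b c)))
      (d * (p a b c * q' a b c + q a b c * p' a b c))"
      unfolding pq(3)[OF d] pq'(3)[OF d] d[symmetric]
      by (simp add: complex_eq_iff algebra_simps power2_eq_square)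
  qed
qed

lemma heron_fun_power:
  assumes "heron_fun F"
  shows "heron_fun (\<lambda>a b c d. F a b c d ^ n)"
proof (induction n)
  case 0
  show ?case using heron_fun_of_rat_poly[OF rat_poly_fun.const[of 1]] by simp
next
  case (Suc n)
  show ?case using heron_fun_mult[OF assms Suc] by simp
qed

lemma heron_fun_sum:
  assumes "finite S" "\<And>s. s \<in> S \<Longrightarrow> heron_fun (F s)"
  shows "heron_fun (\<lambda>a b c d. \<Sum>s\<in>S. F s a b c d)"
  using assms
proof (induction S)
  case empty
  show ?case using heron_fun_of_rat_poly[OF rat_poly_fun.const[of 0]] by simp
next
  case (insert s S)
  then show ?case using heron_fun_add[of "F s" "\<lambda>a b c d. \<Sum>s\<in>S. F s a b c d"] by simp
qed

text \<open>As \<open>d\<close> is real and nonzero, real and imaginary parts give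
  \<open>p = 0\<close> and \<open>q = 0\<close> separately at the independent point; both then
  vanish identically. The target \<open>d'\<close> may be either root of Heron's polynomial.\<close>

lemma heron_fun_vanish:
  assumes "heron_fun F" "alg_indep3 a b c" "d\<^sup>2 = heron a b c" "d \<noteq> 0" "F a b c d = 0"
    and "d'\<^sup>2 = heron a' b' c'"
  shows "F a' b' c' d' = 0"
proof -
  obtain p q where
    pq: "rat_poly_fun p" "rat_poly_fun q" "\<And>a b c d. d\<^sup>2 = heron a b c \<Longrightarrow> F a b c d = Complex (p a b c) (d * q a b c)"
    using assms(1) unfolding heron_fun_def by blast
  have "p a b c = 0" "q a b c = 0"
    using pq(3)[OF assms(3)] assms(4,5) by (auto simp: complex_eq_iff)
  then have "p a' b' c' = 0" "q a' b' c' = 0"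
    using rat_poly_fun_vanish[OF _ assms(2)] pq(1,2) by blast+
  then show ?thesis using pq(3)[OF assms(6)] by (simp add: complex_eq_iff)
qed

section \<open>Laurent relations tested on triangles with arbitrary angles\<close>

lemma bipoly_vanish_infinite:
  fixes k :: "nat \<Rightarrow> nat \<Rightarrow> complex"
  assumes "infinite Z" and 0: "\<And>z w. z \<in> Z \<Longrightarrow> w \<in> Z \<Longrightarrow> (\<Sum>i\<le>n. \<Sum>j\<le>n. k i j * z ^ i * w ^ j) = 0"
    and "i \<le> n" "j \<le> n"
  shows "k i j = 0"
proof -
  have poly0: "c i = 0" if "\<And>z. z \<in> Z \<Longrightarrow> (\<Sum>i\<le>n. c i * z ^ i) = 0" "i \<le> n" for c :: "nat \<Rightarrow> complex" and i
  proof (rule ccontr)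
    assume "c i \<noteq> 0"
    then have "finite {z. (\<Sum>i\<le>n. c i * z ^ i) = 0}"
      using that(2) polyfun_finite_roots[of c n] by blast
    moreover have "Z \<subseteq> {z. (\<Sum>i\<le>n. c i * z ^ i) = 0}" using that(1) by blast
    ultimately show False using assms(1) finite_subset by blast
  qed
  \<comment> \<open>For fixed \<open>w\<close> this sum is the coefficient of \<open>z ^ i\<close>,
    so the one-variable root count applies first in \<open>z\<close> and then in
    \<open>w\<close>.\<close>
  have "(\<Sum>j\<le>n. k i j * w ^ j) = 0" if "w \<in> Z" for w
  proof (rule poly0[of "\<lambda>i. \<Sum>j\<le>n. k i j * w ^ j"])
    fix z assume "z \<in> Z"
    show "(\<Sum>i\<le>n. (\<Sum>j\<le>n. k i j * w ^ j) * z ^ i) = 0"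
      using 0[OF \<open>z \<in> Z\<close> that] by (simp add: sum_distrib_left sum_distrib_right mult_ac)
  qed (rule assms(3))
  then show ?thesis using poly0[of "k i" j] assms(4) by blast
qed

text \<open>By the law of sines, a triangle with angles \<open>s\<close>, \<open>t\<close> and
  circumdiameter 1 has sides \<open>a\<close>, \<open>b\<close>, \<open>c\<close>, and
  \<open>d\<close> is four times its area. The last two claims join the law of cosines (real part)
  to the area formula (imaginary part).\<close>

lemma sine_triangle:
  fixes s t :: real
  defines "a \<equiv> sin s" and "b \<equiv> sin t" and "c \<equiv> sin (s + t)"
  defines "d \<equiv> 2 * sin s * sin t * sin (s + t)"
  shows "d\<^sup>2 = heron a b c"
    and "Complex (b\<^sup>2 + c\<^sup>2 - a\<^sup>2) d = of_real (2 * b * c) * cis s"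
    and "Complex (a\<^sup>2 + c\<^sup>2 - b\<^sup>2) d = of_real (2 * a * c) * cis t"
proof -
  have pyth: "(cos s)\<^sup>2 = 1 - (sin s)\<^sup>2" "(cos t)\<^sup>2 = 1 - (sin t)\<^sup>2"
    by (simp_all add: cos_squared_eq)
  \<comment> \<open>Stated for fresh \<open>s\<close> and \<open>t\<close>, so that exchanging them
    gives both laws of cosines.\<close>
  have *: "(sin t)\<^sup>2 + (sin s * cos t + cos s * sin t)\<^sup>2 - (sin s)\<^sup>2 =
      2 * sin t * (sin s * cos t + cos s * sin t) * cos s"
    if "(cos s)\<^sup>2 = 1 - (sin s)\<^sup>2" "(cos t)\<^sup>2 = 1 - (sin t)\<^sup>2" for s t :: real
  proof -
    have "(sin t)\<^sup>2 + (sin s * cos t + cos s * sin t)\<^sup>2 - (sin s)\<^sup>2 -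
        2 * sin t * (sin s * cos t + cos s * sin t) * cos s =
      (sin t)\<^sup>2 + (sin s)\<^sup>2 * (cos t)\<^sup>2 - (sin s)\<^sup>2 - (cos s)\<^sup>2 * (sin t)\<^sup>2"
      by (simp add: algebra_simps power2_eq_square)
    also have "\<dots> = 0" unfolding that by (simp add: algebra_simps)
    finally show ?thesis by simp
  qed
  have A: "b\<^sup>2 + c\<^sup>2 - a\<^sup>2 = 2 * b * c * cos s"
    unfolding a_def b_def c_def sin_add by (rule *[OF pyth])
  have B: "a\<^sup>2 + c\<^sup>2 - b\<^sup>2 = 2 * a * c * cos t"
    using *[OF pyth(2,1)] unfolding a_def b_def c_def sin_add by (simp add: algebra_simps)
  have "heron a b c = (2 * b * c)\<^sup>2 - (b\<^sup>2 + c\<^sup>2 - a\<^sup>2)\<^sup>2"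
    unfolding heron_def by (simp add: algebra_simps power2_eq_square power4_eq_xxxx)
  also have "\<dots> = (2 * b * c)\<^sup>2 * (1 - (cos s)\<^sup>2)"
    unfolding A by (simp add: algebra_simps power2_eq_square)
  also have "\<dots> = d\<^sup>2"
    unfolding pyth a_def b_def c_def d_def by (simp add: algebra_simps power2_eq_square)
  finally show "d\<^sup>2 = heron a b c" by simp
  show "Complex (b\<^sup>2 + c\<^sup>2 - a\<^sup>2) d = of_real (2 * b * c) * cis s"
    unfolding A by (simp add: complex_eq_iff d_def a_def b_def c_def)
  show "Complex (a\<^sup>2 + c\<^sup>2 - b\<^sup>2) d = of_real (2 * a * c) * cis t"
    unfolding B by (simp add: complex_eq_iff d_def a_def b_def c_def)
qed

text \<open>By the law of cosines, \<open>x\<close> and \<open>y\<close> are the squares of the unit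
  complex numbers at the first two angles. Clearing denominators puts the relation into the ring of
  \<open>heron_fun\<close>; independence then transports it to the triangles of
  \<open>sine_triangle\<close>, whose two angles vary freely.\<close>

lemma laurent_independent:
  fixes a b c d :: real and k :: "int \<times> int \<Rightarrow> int"
  defines "x \<equiv> (Complex (b\<^sup>2 + c\<^sup>2 - a\<^sup>2) d)\<^sup>2 / of_real ((2 * b * c)\<^sup>2)"
    and "y \<equiv> (Complex (a\<^sup>2 + c\<^sup>2 - b\<^sup>2) d)\<^sup>2 / of_real ((2 * a * c)\<^sup>2)"
  assumes indep: "alg_indep3 a b c" and d: "d\<^sup>2 = heron a b c" "d \<noteq> 0" and pos: "a > 0" "b > 0" "c > 0"
    and fin: "finite S" and sum0: "(\<Sum>(m, n)\<in>S. of_int (k (m, n)) * (x powi m * y powi n)) = 0"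
    and mem: "e \<in> S"
  shows "k e = 0"
proof -
  \<comment> \<open>A common bound for all exponents; shifting by \<open>N\<close> places them
    between 0 and \<open>2 * N\<close>.\<close>
  obtain N :: nat where N: "\<And>m n. (m, n) \<in> S \<Longrightarrow> \<bar>m\<bar> \<le> int N \<and> \<bar>n\<bar> \<le> int N"
  proof -
    have "finite ((\<lambda>(m, n). nat (max \<bar>m\<bar> \<bar>n\<bar>)) ` S)" using fin by simp
    then obtain N where "\<forall>v \<in> (\<lambda>(m, n). nat (max \<bar>m\<bar> \<bar>n\<bar>)) ` S. v \<le> N"
      by (meson finite_nat_set_iff_bounded_le)
    then show ?thesis by (intro that[of N]) (force simp: max_def split: if_splits)
  qed
  define numx where "numx a b c d = (Complex (b\<^sup>2 + c\<^sup>2 - a\<^sup>2) d)\<^sup>2" for a b c d :: real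
  define numy where "numy a b c d = (Complex (a\<^sup>2 + c\<^sup>2 - b\<^sup>2) d)\<^sup>2" for a b c d :: real
  define den where "den b c = complex_of_real ((2 * b * c)\<^sup>2)" for b c :: real
  \<comment> \<open>The relation multiplied by \<open>(x * y) ^ N\<close> and by
    \<open>(den b c * den a c) ^ (2 * N)\<close>, so that only natural powers and no divisions
    remain.\<close>
  define cleared where "cleared a b c d = (\<Sum>e\<in>S. of_real (of_int (k e)) *
      (numx a b c d ^ nat (fst e + int N) * den b c ^ nat (int N - fst e) *
      (numy a b c d ^ nat (snd e + int N) * den a c ^ nat (int N - snd e))))" for a b c d
  have mono: "U ^ nat (m + int N) * p ^ nat (int N - m) = p ^ (2 * N) * (U / p) ^ nat (m + int N)"
    if "p \<noteq> 0" "\<bar>m\<bar> \<le> int N" for U p :: complex and m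
  proof -
    have "2 * N = nat (m + int N) + nat (int N - m)" using that by linarith
    then have "p ^ (2 * N) = p ^ nat (m + int N) * p ^ nat (int N - m)" by (metis power_add)
    with that show ?thesis by (simp add: power_divide)
  qed
  have cleared_eq: "cleared a b c d = (den b c * den a c) ^ (2 * N) * (\<Sum>e\<in>S. of_int (k e) *
      ((numx a b c d / den b c) ^ nat (fst e + int N) * (numy a b c d / den a c) ^ nat (snd e + int N)))"
    if "den b c \<noteq> 0" "den a c \<noteq> 0" for a b c d
    unfolding cleared_def sum_distrib_left using N that
    by (intro sum.cong refl) (auto simp: mono power_mult_distrib)
  have heron_base: "heron_fun (\<lambda>a b c d. Complex (p a b c) d)" if "rat_poly_fun p" for p
    unfolding heron_fun_def using that rat_poly_fun.const[of 1]
    by (intro exI[of _ p] exI[of _ "\<lambda>a b c. 1"]) auto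
  have "rat_poly_fun (\<lambda>a b c. b * b + c * c + (-1) * (a * a))"
    "rat_poly_fun (\<lambda>a b c. a * a + c * c + (-1) * (b * b))"
    by (intro rat_poly_fun.intros; simp)+
  from this[THEN heron_base] have base: "heron_fun (\<lambda>a b c d. Complex (b\<^sup>2 + c\<^sup>2 - a\<^sup>2) d)"
    "heron_fun (\<lambda>a b c d. Complex (a\<^sup>2 + c\<^sup>2 - b\<^sup>2) d)"
    by (simp_all add: power2_eq_square)
  have "rat_poly_fun (\<lambda>a b c. 2 * b * c * (2 * b * c))" "rat_poly_fun (\<lambda>a b c. 2 * a * c * (2 * a * c))"
    by (intro rat_poly_fun.intros; simp)+
  from this[THEN heron_fun_of_rat_poly] have "heron_fun (\<lambda>a b c d. den b c)" "heron_fun (\<lambda>a b c d. den a c)"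
    unfolding den_def power2_eq_square by simp_all
  moreover have "heron_fun numx" "heron_fun numy"
    unfolding numx_def numy_def using base[THEN heron_fun_power] by simp_all
  moreover have "heron_fun (\<lambda>a b c d. complex_of_real (of_int (k e)))" for e
    by (rule heron_fun_of_rat_poly, rule rat_poly_fun.const) simp
  ultimately have "heron_fun cleared"
    unfolding cleared_def by (intro heron_fun_sum fin heron_fun_mult heron_fun_power)
  moreover have "cleared a b c d = 0"
  proof -
    have xy: "x = numx a b c d / den b c" "y = numy a b c d / den a c"
      by (simp_all add: x_def y_def numx_def numy_def den_def)
    have nz: "den b c \<noteq> 0" "den a c \<noteq> 0" "x \<noteq> 0" "y \<noteq> 0"
      using pos d by (auto simp: den_def x_def y_def Complex_eq_0)
    have pw: "u ^ nat (m + int N) = u ^ N * u powi m" if "\<bar>m\<bar> \<le> int N" "u \<noteq> 0" for u :: complex and m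
    proof -
      have "u ^ nat (m + int N) = u powi (m + int N)" using that by (simp add: power_int_def)
      then show ?thesis using that by (simp add: power_int_add)
    qed
    have "(\<Sum>e\<in>S. of_int (k e) * (x ^ nat (fst e + int N) * y ^ nat (snd e + int N)))
      = (x * y) ^ N * (\<Sum>(m, n)\<in>S. of_int (k (m, n)) * (x powi m * y powi n))"
      unfolding sum_distrib_left using N nz
      by (intro sum.cong refl) (auto simp: pw power_mult_distrib)
    then show ?thesis using cleared_eq[OF nz(1,2)] by (simp add: xy[symmetric] sum0)
  qed
  ultimately have cleared0: "cleared a' b' c' d' = 0" if "d'\<^sup>2 = heron a' b' c'" for a' b' c' d'
    using heron_fun_vanish indep d that by blast
  \<comment> \<open>The coefficients after the shift by \<open>N\<close>, extended by zero to the
    full square of exponents.\<close>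
  define coef where "coef i j = (if (int i - int N, int j - int N) \<in> S then complex_of_int (k (int i - int N, int j - int N)) else 0)" for i j
  \<comment> \<open>Angles below \<open>pi / 2\<close> keep \<open>s + t\<close> below
    \<open>pi\<close>, so all three sines are positive and the pair of angles ranges over a full
    product.\<close>
  define Z where "Z = (\<lambda>s. (cis s)\<^sup>2) ` {0<..<pi / 2}"
  have "inj_on (\<lambda>s. (cis s)\<^sup>2) {0<..<pi / 2}"
  proof (rule inj_onI)
    fix s t assume "s \<in> {0<..<pi / 2}" "t \<in> {0<..<pi / 2}" "(cis s)\<^sup>2 = (cis t)\<^sup>2"
    then have "cos (2 * s) = cos (2 * t)" "0 \<le> 2 * s" "2 * s \<le> pi" "0 \<le> 2 * t" "2 * t \<le> pi"
      unfolding Complex.DeMoivre by (auto simp: complex_eq_iff)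
    then have "2 * s = 2 * t" using cos_inj_pi by blast
    then show "s = t" by simp
  qed
  then have "infinite Z" unfolding Z_def
    by (subst finite_image_iff) (auto intro!: infinite_Ioo)
  moreover have "(\<Sum>i\<le>2 * N. \<Sum>j\<le>2 * N. coef i j * z ^ i * w ^ j) = 0" if "z \<in> Z" "w \<in> Z" for z w
  proof -
    obtain s t where st: "s \<in> {0<..<pi / 2}" "t \<in> {0<..<pi / 2}" and zw: "z = (cis s)\<^sup>2" "w = (cis t)\<^sup>2"
      using \<open>z \<in> Z\<close> \<open>w \<in> Z\<close> unfolding Z_def by blast
    let ?a = "sin s" and ?b = "sin t" and ?c = "sin (s + t)" and ?d = "2 * sin s * sin t * sin (s + t)"
    have pos: "?a > 0" "?b > 0" "?c > 0" using st by (auto intro!: sin_gt_zero)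
    then have nz: "den ?b ?c \<noteq> 0" "den ?a ?c \<noteq> 0" by (auto simp: den_def)
    have "numx ?a ?b ?c ?d / den ?b ?c = z" "numy ?a ?b ?c ?d / den ?a ?c = w"
      using nz unfolding numx_def numy_def den_def sine_triangle zw by (simp_all add: power_mult_distrib)
    then have "(\<Sum>e\<in>S. of_int (k e) * (z ^ nat (fst e + int N) * w ^ nat (snd e + int N))) = 0"
      using cleared_eq[OF nz, of ?d] cleared0[OF sine_triangle(1)] nz by simp
    moreover have "(\<Sum>i\<le>2 * N. \<Sum>j\<le>2 * N. coef i j * z ^ i * w ^ j) =
        (\<Sum>e\<in>S. of_int (k e) * (z ^ nat (fst e + int N) * w ^ nat (snd e + int N)))"
    proof -
      define h where "h e = (nat (fst e + int N), nat (snd e + int N))" for e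
      have N': "\<bar>fst e\<bar> \<le> int N" "\<bar>snd e\<bar> \<le> int N" if "e \<in> S" for e
        using N[of "fst e" "snd e"] that by simp_all
      have inj: "inj_on h S"
      proof (rule inj_onI)
        fix e e' assume "e \<in> S" "e' \<in> S" "h e = h e'"
        then show "e = e'" using N'[of e] N'[of e'] by (auto simp: h_def prod_eq_iff)
      qed
      have sub: "h ` S \<subseteq> {..2 * N} \<times> {..2 * N}"
      proof (rule image_subsetI)
        fix e assume "e \<in> S"
        then show "h e \<in> {..2 * N} \<times> {..2 * N}" using N'[of e] by (auto simp: h_def)
      qed
      have out: "coef i j = 0" if "(i, j) \<notin> h ` S" for i j
      proof -
        have "(int i - int N, int j - int N) \<notin> S"
        proof
          assume "(int i - int N, int j - int N) \<in> S"
          then have "h (int i - int N, int j - int N) \<in> h ` S" by (rule imageI)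
          with that show False by (simp add: h_def)
        qed
        then show ?thesis by (simp add: coef_def)
      qed
      have "(\<Sum>i\<le>2 * N. \<Sum>j\<le>2 * N. coef i j * z ^ i * w ^ j) = (\<Sum>(i, j)\<in>h ` S. coef i j * z ^ i * w ^ j)"
        unfolding sum.cartesian_product using out sub by (intro sum.mono_neutral_right) auto
      also have "\<dots> = (\<Sum>e\<in>S. case h e of (i, j) \<Rightarrow> coef i j * z ^ i * w ^ j)"
        by (simp add: sum.reindex[OF inj])
      also have "\<dots> = (\<Sum>e\<in>S. of_int (k e) * (z ^ nat (fst e + int N) * w ^ nat (snd e + int N)))"
        proof (rule sum.cong[OF refl])
        fix e assume "e \<in> S"
        then have "int (nat (fst e + int N)) - int N = fst e" "int (nat (snd e + int N)) - int N = snd e"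
          using N'[of e] by linarith+
        with \<open>e \<in> S\<close> have "coef (nat (fst e + int N)) (nat (snd e + int N)) = of_int (k e)"
          by (simp only: coef_def prod.collapse if_True)
        then show "(case h e of (i, j) \<Rightarrow> coef i j * z ^ i * w ^ j) =
            of_int (k e) * (z ^ nat (fst e + int N) * w ^ nat (snd e + int N))"
          by (simp add: h_def mult.assoc)
      qed
      finally show ?thesis .
    qed
    ultimately show ?thesis by simp
  qed
  ultimately have coef0: "coef i j = 0" if "i \<le> 2 * N" "j \<le> 2 * N" for i j
    using bipoly_vanish_infinite that by blast
  have Ne: "\<bar>fst e\<bar> \<le> int N" "\<bar>snd e\<bar> \<le> int N"
    using N[of "fst e" "snd e"] mem by simp_all
  have "int (nat (fst e + int N)) - int N = fst e" "int (nat (snd e + int N)) - int N = snd e"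
    using Ne by linarith+
  with mem have "coef (nat (fst e + int N)) (nat (snd e + int N)) = of_int (k e)"
    by (simp only: coef_def prod.collapse if_True)
  with coef0[of "nat (fst e + int N)" "nat (snd e + int N)"] Ne show ?thesis by simp
qed

section \<open>Isometries of the plane\<close>

definition transl :: "complex \<Rightarrow> complex \<Rightarrow> complex" where
  "transl c z = z + c"

lemma transl_0: "transl 0 = id"
  by (simp add: transl_def fun_eq_iff)

lemma is_translation_iff: "is_translation f \<longleftrightarrow> (\<exists>c. f = transl c)"
  by (simp add: is_translation_def transl_def[abs_def])

lemma carrier_E2: "f \<in> carrier E2 \<longleftrightarrow> surj f \<and> (\<forall>x y. dist (f x) (f y) = dist x y)"
  by (simp add: E2_def)

lemma mult_E2: "g \<otimes>\<^bsub>E2\<^esub> h = h \<circ> g"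
  by (simp add: E2_def)

lemma one_E2: "\<one>\<^bsub>E2\<^esub> = id"
  by (simp add: E2_def)

lemma group_E2: "group E2"
proof (rule groupI)
  fix f assume f: "f \<in> carrier E2"
  then have bij: "bij f" unfolding carrier_E2 bij_def inj_def by (metis dist_eq_0_iff)
  have "dist (inv_into UNIV f x) (inv_into UNIV f y) = dist x y" for x y
    using f bij unfolding carrier_E2 by (metis surj_f_inv_f)
  moreover have "surj (inv_into UNIV f)" using bij bij_imp_bij_inv bij_is_surj by blast
  ultimately have "inv_into UNIV f \<in> carrier E2" by (simp add: carrier_E2)
  moreover have "inv_into UNIV f \<otimes>\<^bsub>E2\<^esub> f = \<one>\<^bsub>E2\<^esub>"
    using bij by (auto simp: mult_E2 one_E2 fun_eq_iff surj_f_inv_f bij_is_surj)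
  ultimately show "\<exists>g\<in>carrier E2. g \<otimes>\<^bsub>E2\<^esub> f = \<one>\<^bsub>E2\<^esub>" by blast
next
  fix f g assume "f \<in> carrier E2" "g \<in> carrier E2"
  then show "f \<otimes>\<^bsub>E2\<^esub> g \<in> carrier E2" 
    unfolding carrier_E2 mult_E2 by (intro conjI comp_surj) auto
qed (auto simp: carrier_E2 mult_E2 one_E2 comp_assoc)

interpretation E2: group E2 by (rule group_E2)

lemma transl_carrier: "transl c \<in> carrier E2"
  by (auto simp: carrier_E2 transl_def intro!: surjI[of _ "\<lambda>z. z - c"])

lemma transl_mult: "transl c \<otimes>\<^bsub>E2\<^esub> transl d = transl (c + d)"
  by (auto simp: mult_E2 fun_eq_iff transl_def)

lemma transl_inv: "inv\<^bsub>E2\<^esub> (transl c) = transl (- c)"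
  by (rule E2.inv_equality) (auto simp: transl_carrier transl_mult one_E2 transl_0)

lemma transl_nat_pow: "transl c [^]\<^bsub>E2\<^esub> (n::nat) = transl (of_nat n * c)"
  by (induction n) (auto simp: one_E2 transl_mult transl_0 algebra_simps)

lemma transl_int_pow: "transl c [^]\<^bsub>E2\<^esub> (n::int) = transl (of_int n * c)"
proof (cases "n < 0")
  case True
  then have "complex_of_nat (nat (- n)) = - of_int n" by simp
  with True show ?thesis by (simp add: int_pow_def2 transl_nat_pow transl_inv)
next
  case False
  then show ?thesis by (simp add: int_pow_def2 transl_nat_pow)
qed

lemma transl_inject: "transl c = transl d \<longleftrightarrow> c = d"
  by (metis add_left_cancel transl_def)

text \<open>The hypothesis says that translating by \<open>c\<close> and then applying
  \<open>g\<close> is the same as applying \<open>g\<close> and then translating by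
  \<open>d\<close>; cancelling \<open>g\<close> gives the conjugate.\<close>

lemma inv_conj_transl:
  assumes "g \<in> carrier E2" "\<And>z. g (z + c) = g z + d"
  shows "inv\<^bsub>E2\<^esub> g \<otimes>\<^bsub>E2\<^esub> transl c \<otimes>\<^bsub>E2\<^esub> g = transl d"
proof -
  have "transl c \<otimes>\<^bsub>E2\<^esub> g = g \<otimes>\<^bsub>E2\<^esub> transl d"
    using assms(2) by (auto simp: mult_E2 fun_eq_iff transl_def)
  then have "inv\<^bsub>E2\<^esub> g \<otimes>\<^bsub>E2\<^esub> (transl c \<otimes>\<^bsub>E2\<^esub> g) = transl d"
    using assms(1) transl_carrier by (simp flip: E2.m_assoc add: E2.l_inv)
  then show ?thesis using assms(1) transl_carrier by (simp add: E2.m_assoc)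
qed

text \<open>\<open>E2\<close> is not commutative, so \<open>finprod\<close> is evaluated through left commutativity on translations.\<close>

lemma finprod_transl:
  fixes f :: "'a \<Rightarrow> complex"
  assumes "finite S" "\<And>s. s \<in> S \<Longrightarrow> F s = transl (f s)"
  shows "finprod E2 F S = transl (\<Sum>s\<in>S. f s)"
  using assms
proof (induction S)
  case empty
  show ?case by (simp add: finprod_def transl_0 one_E2[symmetric])
next
  case (insert s S)
  interpret LCD "insert s S" "carrier E2" "mult E2 \<circ> F"
  proof
    fix p q h assume "p \<in> insert s S" "q \<in> insert s S" "h \<in> carrier E2"
    then have "F p = transl (f p)" "F q = transl (f q)" using insert.prems by auto
    then show "(mult E2 \<circ> F) p ((mult E2 \<circ> F) q h) = (mult E2 \<circ> F) q ((mult E2 \<circ> F) p h)"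
      by (auto simp: mult_E2 fun_eq_iff transl_def add_ac)
  next
    fix p h assume "p \<in> insert s S" "h \<in> carrier E2"
    moreover from this have "F p \<in> carrier E2" using insert.prems transl_carrier by auto
    ultimately show "(mult E2 \<circ> F) p h \<in> carrier E2" by simp
  qed
  have "finprod E2 F (insert s S) = F s \<otimes>\<^bsub>E2\<^esub> finprod E2 F S"
    unfolding finprod_def using insert.hyps by (simp add: foldD_insert subset_insertI)
  then show ?case using insert by (simp add: transl_mult)
qed

lemma int_step_induct:
  fixes n :: int
  assumes "P 0" "\<And>i. P i \<Longrightarrow> P (i + 1)" "\<And>i. P i \<Longrightarrow> P (i - 1)"
  shows "P n"
  using assms by (induction n rule: int_induct[of _ 0]) auto

section \<open>Reflections and angles in complex form\<close>

lemma reflection_line_carrier: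
  assumes "P \<noteq> Q"
  shows "reflection_line P Q \<in> carrier E2"
    and "reflection_line P Q \<otimes>\<^bsub>E2\<^esub> reflection_line P Q = \<one>\<^bsub>E2\<^esub>"
proof -
  have nz: "cnj (Q - P) \<noteq> 0" using assms by auto
  then have u: "norm ((Q - P) / cnj (Q - P)) = 1" using assms by (simp add: norm_divide flip: complex_cnj_diff)
  have invol: "reflection_line P Q (reflection_line P Q z) = z" for z
    using nz assms by (simp add: reflection_line_def flip: complex_cnj_diff)
  have "dist (reflection_line P Q x) (reflection_line P Q y) = dist x y" for x y
  proof -
    have "reflection_line P Q x - reflection_line P Q y = ((Q - P) / cnj (Q - P)) * cnj (x - y)"
      by (simp add: reflection_line_def algebra_simps diff_divide_distrib)
    then show ?thesis by (simp only: dist_norm norm_mult u complex_mod_cnj mult_1)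
  qed
  with invol show "reflection_line P Q \<in> carrier E2"
    by (auto simp: carrier_E2 intro!: surjI)
  show "reflection_line P Q \<otimes>\<^bsub>E2\<^esub> reflection_line P Q = \<one>\<^bsub>E2\<^esub>"
    using invol by (auto simp: mult_E2 one_E2 fun_eq_iff)
qed

text \<open>The direction of the line contributes \<open>C / cnj C\<close> and the reflected vector
  \<open>cnj C\<close>; the product is \<open>C\<close>, so reflections keep their shape in the
  coordinate \<open>z\<close>.\<close>

lemma reflection_line_chart:
  assumes "C \<noteq> 0" "p \<noteq> q"
  shows "reflection_line (A + C * p) (A + C * q) (A + C * z) =
    A + C * (p + (q - p) / cnj (q - p) * cnj (z - p))"
proof -
  have 1: "A + C * q - (A + C * p) = C * (q - p)" "A + C * z - (A + C * p) = C * (z - p)"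
    by (simp_all add: algebra_simps)
  have "C * (q - p) / cnj (C * (q - p)) * cnj (C * (z - p)) = C * ((q - p) / cnj (q - p) * cnj (z - p))"
    using assms by (simp del: complex_cnj_diff)
  then show ?thesis unfolding reflection_line_def 1 by (simp add: algebra_simps)
qed

text \<open>\<open>vertex_angle\<close> is unsigned and lies between 0 and \<open>pi\<close>, so its
  sine is nonnegative; the sign of \<open>Im \<rho>\<close> supplies the orientation.\<close>

lemma vertex_angle_cis:
  fixes P Q R :: complex
  defines "\<rho> \<equiv> (R - P) / (Q - P)"
  assumes "Im \<rho> \<noteq> 0"
  shows "cis (sgn (Im \<rho>) * vertex_angle P Q R) = sgn \<rho>"
proof -
  have nz: "Q - P \<noteq> 0" "\<rho> \<noteq> 0" using assms by auto
  have R: "R - P = (Q - P) * \<rho>" using nz by (simp add: \<rho>_def)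
  have "(Q - P) \<bullet> (R - P) = (norm (Q - P))\<^sup>2 * Re \<rho>"
    unfolding R cmod_power2 by (simp add: inner_complex_def algebra_simps power2_eq_square)
  then have "((Q - P) \<bullet> (R - P)) / (norm (Q - P) * norm (R - P)) = Re \<rho> / norm \<rho>"
    unfolding R norm_mult using nz by (simp add: power2_eq_square)
  then have ang: "vertex_angle P Q R = arccos (Re \<rho> / norm \<rho>)"
    by (simp add: vertex_angle_def)
  have le: "\<bar>Re \<rho> / norm \<rho>\<bar> \<le> 1"
    using nz abs_Re_le_cmod[of \<rho>] by (simp add: abs_divide)
  have cos: "cos (vertex_angle P Q R) = Re \<rho> / norm \<rho>"
    unfolding ang using le[unfolded abs_le_iff] by (intro cos_arccos) linarith+
  have "(Re \<rho> / norm \<rho>)\<^sup>2 + (Im \<rho> / norm \<rho>)\<^sup>2 = 1"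
    using nz by (simp add: power_divide flip: add_divide_distrib cmod_power2)
  then have "1 - (Re \<rho> / norm \<rho>)\<^sup>2 = (Im \<rho> / norm \<rho>)\<^sup>2" by simp
  then have "sin (vertex_angle P Q R) = \<bar>Im \<rho> / norm \<rho>\<bar>"
    unfolding ang sin_arccos_abs[OF le] by (simp only: real_sqrt_abs)
  then have sin: "sin (vertex_angle P Q R) = \<bar>Im \<rho>\<bar> / norm \<rho>"
    by (simp add: abs_divide)
  have "cis (sgn (Im \<rho>) * vertex_angle P Q R) = Complex (Re \<rho> / norm \<rho>) (Im \<rho> / norm \<rho>)"
    using assms(2) by (cases "Im \<rho> > 0") (simp_all add: complex_eq_iff cos sin sgn_if)
  also have "\<dots> = sgn \<rho>" by (simp add: complex_eq_iff)
  finally show ?thesis .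
qed

text \<open>Squaring a direction gives the rotation by twice its angle, which is the shape in which
  \<open>x\<close> and \<open>y\<close> are defined.\<close>

lemma sgn_power2_complex: "(sgn z)\<^sup>2 = z / cnj z" for z :: complex
proof (cases "z = 0")
  case False
  have "(sgn z)\<^sup>2 = z\<^sup>2 / of_real ((norm z)\<^sup>2)"
    by (simp add: sgn_eq power_divide)
  also have "\<dots> = z\<^sup>2 / (z * cnj z)"
    by (simp only: complex_norm_square)
  finally have "(sgn z)\<^sup>2 = z\<^sup>2 / (z * cnj z)" .
  with False show ?thesis by (simp add: power2_eq_square)
qed simp

section \<open>The triangle group\<close>

locale triangle =
  fixes A1 A2 A3 :: complex
  assumes nondeg: "nondegenerate_triangle A1 A2 A3"
begin

text \<open>\<open>x\<close> and \<open>y\<close> are the rotations by twice the signed angles at \<open>A1\<close> and \<open>A2\<close>.\<close>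

definition "C = A2 - A1"
definition "w = (A3 - A1) / C"
definition "x = w / cnj w"
definition "y = cnj (1 - w) / (1 - w)"
definition "v = (1 - 1 / y) * (1 / x - 1)"
definition "xy_pow (a :: int) (b :: int) = x powi a * y powi b"

abbreviation "G \<equiv> triangle_group A1 A2 A3"
abbreviation "T \<equiv> translation_subgroup A1 A2 A3"
abbreviation "B \<equiv> conj_class (triangle_group A1 A2 A3) (t1 A1 A2 A3)"

lemma C_nz: "C \<noteq> 0" and Im_w: "Im w \<noteq> 0"
proof -
  have "\<not> collinear {0, C, A3 - A1}"
    using nondeg collinear_3[of A2 A1 A3] unfolding nondegenerate_triangle_def C_def
    by (simp add: insert_commute collinear_3[of A2 A1 A3])
  then show "C \<noteq> 0" "Im w \<noteq> 0"
    unfolding collinear_iff_Reals w_def by (auto simp: complex_is_Real_iff)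
qed

lemma vertices: "A1 = A1 + C * 0" "A2 = A1 + C * 1" "A3 = A1 + C * w"
  using C_nz by (simp_all add: C_def w_def)

lemma w_nz: "w \<noteq> 0" "cnj w \<noteq> 0" "1 - w \<noteq> 0" "1 - cnj w \<noteq> 0" "w \<noteq> 1" "cnj w \<noteq> 1" "w \<noteq> cnj w"
  using Im_w by (auto simp: complex_eq_iff)

lemma xy_nz: "x \<noteq> 0" "y \<noteq> 0"
  using w_nz by (auto simp: x_def y_def)

lemma xy_neq_1: "x \<noteq> 1" "y \<noteq> 1"
  using w_nz by (auto simp: x_def y_def)

lemma cnj_xy: "cnj x = 1 / x" "cnj y = 1 / y"
  by (auto simp: x_def y_def)

lemma v_nz: "v \<noteq> 0"
  using xy_nz xy_neq_1 by (auto simp: v_def divide_eq_eq eq_divide_eq)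

text \<open>Conjugation multiplies \<open>v\<close> by a monomial, so orientation-reversing elements
  produce no vectors beyond the monomial multiples of \<open>v\<close>.\<close>

lemma cnj_v: "cnj v = x * y * v"
  using xy_nz by (simp add: v_def cnj_xy field_simps)

lemma xy_pow_0 [simp]: "xy_pow 0 0 = 1"
  by (simp add: xy_pow_def)

lemma xy_pow_mult: "xy_pow a b * xy_pow c d = xy_pow (a + c) (b + d)"
  using xy_nz by (simp add: xy_pow_def power_int_add)

lemma cnj_xy_pow: "cnj (xy_pow a b) = xy_pow (- a) (- b)"
  by (simp add: xy_pow_def cnj_xy power_int_minus power_int_inverse divide_inverse)

lemma xy_pow_simps: "xy_pow 1 0 = x" "xy_pow (-1) 0 = 1 / x" "xy_pow 0 1 = y" "xy_pow 0 (-1) = 1 / y" "xy_pow 1 1 = x * y"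
  by (simp_all add: xy_pow_def power_int_minus divide_inverse)

section \<open>The reflections and \<open>t1\<close> in the coordinate \<open>z\<close>\<close>

lemma r3_chart: "r3 A1 A2 A3 (A1 + C * z) = A1 + C * cnj z"
  using reflection_line_chart[OF C_nz, of 0 1 A1 z] vertices by (simp add: r3_def)

lemma r2_chart: "r2 A1 A2 A3 (A1 + C * z) = A1 + C * (x * cnj z)"
proof -
  have "r2 A1 A2 A3 (A1 + C * z) = A1 + C * (w + w / cnj w * (cnj z - cnj w))"
    using reflection_line_chart[OF C_nz, of w 0 A1 z] w_nz vertices by (simp add: r2_def)
  also have "w + w / cnj w * (cnj z - cnj w) = x * cnj z"
    using w_nz by (simp add: x_def field_simps)
  finally show ?thesis .
qed

lemma r1_chart: "r1 A1 A2 A3 (A1 + C * z) = A1 + C * (1 / y * cnj z + 1 - 1 / y)"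
proof -
  have "r1 A1 A2 A3 (A1 + C * z) = A1 + C * (1 + (w - 1) / (cnj w - 1) * (cnj z - 1))"
    using reflection_line_chart[OF C_nz, of 1 w A1 z] w_nz vertices by (simp add: r1_def)
  also have "1 + (w - 1) / (cnj w - 1) * (cnj z - 1) = 1 / y * cnj z + 1 - 1 / y"
  proof -
    have "(w - 1) / (cnj w - 1) = 1 / y"
      using w_nz by (simp add: y_def divide_simps) (simp add: algebra_simps)
    then show ?thesis by (simp only: right_diff_distrib) simp
  qed
  finally show ?thesis .
qed

lemma chart_ext: "(\<And>z. f (A1 + C * z) = g (A1 + C * z)) \<Longrightarrow> f = g"
proof
  fix u assume "\<And>z. f (A1 + C * z) = g (A1 + C * z)"
  from this[of "(u - A1) / C"] show "f u = g u" using C_nz by simp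
qed

lemma refl_carrier:
  "r1 A1 A2 A3 \<in> carrier E2" "r2 A1 A2 A3 \<in> carrier E2" "r3 A1 A2 A3 \<in> carrier E2"
  and refl_invol: "inv\<^bsub>E2\<^esub> r1 A1 A2 A3 = r1 A1 A2 A3" "inv\<^bsub>E2\<^esub> r2 A1 A2 A3 = r2 A1 A2 A3"
    "inv\<^bsub>E2\<^esub> r3 A1 A2 A3 = r3 A1 A2 A3"
proof -
  have "A2 \<noteq> A3" "A3 \<noteq> A1" "A1 \<noteq> A2"
    using C_nz w_nz by (auto simp: C_def w_def)
  then show "r1 A1 A2 A3 \<in> carrier E2" "r2 A1 A2 A3 \<in> carrier E2" "r3 A1 A2 A3 \<in> carrier E2"
    "inv\<^bsub>E2\<^esub> r1 A1 A2 A3 = r1 A1 A2 A3" "inv\<^bsub>E2\<^esub> r2 A1 A2 A3 = r2 A1 A2 A3"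
    "inv\<^bsub>E2\<^esub> r3 A1 A2 A3 = r3 A1 A2 A3"
    unfolding r1_def r2_def r3_def
    by (auto intro!: E2.inv_equality reflection_line_carrier)
qed

lemma G_subgroup: "subgroup G E2"
  unfolding triangle_group_def by (rule E2.generate_is_subgroup) (auto simp: refl_carrier)

lemma refl_in_G: "r1 A1 A2 A3 \<in> G" "r2 A1 A2 A3 \<in> G" "r3 A1 A2 A3 \<in> G"
  unfolding triangle_group_def by (auto intro: generate.incl)

lemma t1_eq: "t1 A1 A2 A3 = transl (C * v)"
proof (rule chart_ext)
  fix z
  \<comment> \<open>Products act from left to right, so \<open>r1\<close> is applied first and
    stands innermost.\<close>
  have "t1 A1 A2 A3 u = r3 A1 A2 A3 (r2 A1 A2 A3 (r1 A1 A2 A3 (r3 A1 A2 A3 (r2 A1 A2 A3 (r1 A1 A2 A3 u)))))" for u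
    by (simp add: t1_def numeral_2_eq_2 mult_E2 one_E2)
  then have "t1 A1 A2 A3 (A1 + C * z) = A1 + C * cnj (x * cnj (1 / y * cnj (cnj (x * cnj (1 / y * cnj z + 1 - 1 / y))) + 1 - 1 / y))"
    by (simp only: r1_chart r2_chart r3_chart)
  also have "cnj (x * cnj (1 / y * cnj (cnj (x * cnj (1 / y * cnj z + 1 - 1 / y))) + 1 - 1 / y)) = z + v"
    using xy_nz by (simp add: cnj_xy v_def field_simps)
  finally have "t1 A1 A2 A3 (A1 + C * z) = A1 + C * (z + v)" .
  then show "t1 A1 A2 A3 (A1 + C * z) = transl (C * v) (A1 + C * z)" by (simp add: transl_def algebra_simps)
qed

section \<open>The module over Z[x, 1/x, y, 1/y] generated by \<open>v\<close>\<close>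

inductive_set M :: "complex set" where
  zero: "0 \<in> M"
| plus: "m \<in> M \<Longrightarrow> m + xy_pow a b * v \<in> M"
| minus: "m \<in> M \<Longrightarrow> m - xy_pow a b * v \<in> M"

lemma M_add: "m' \<in> M \<Longrightarrow> m \<in> M \<Longrightarrow> m + m' \<in> M"
proof (induction m' rule: M.induct)
  case (plus m' a b)
  then show ?case using M.plus[of "m + m'" a b] by (simp add: add.assoc)
next
  case (minus m' a b)
  then show ?case using M.minus[of "m + m'" a b] by (simp add: add_diff_eq)
qed simp

lemma M_uminus: "m \<in> M \<Longrightarrow> - m \<in> M"
proof (induction m rule: M.induct)
  case (plus m' a b)
  then show ?case using M.minus[of "- m'" a b] by simp
next
  case (minus m' a b)
  then show ?case using M.plus[of "- m'" a b] by (simp add: add.commute)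
qed (simp add: M.zero)

lemma M_diff: "m \<in> M \<Longrightarrow> m' \<in> M \<Longrightarrow> m - m' \<in> M"
  using M_add[OF M_uminus] by simp

lemma M_xy_pow: "m \<in> M \<Longrightarrow> xy_pow a b * m \<in> M"
proof (induction m rule: M.induct)
  case (plus m' c d)
  then show ?case using M.plus[of "xy_pow a b * m'" "a + c" "b + d"]
    by (simp add: distrib_left xy_pow_mult flip: mult.assoc)
next
  case (minus m' c d)
  then show ?case using M.minus[of "xy_pow a b * m'" "a + c" "b + d"]
    by (simp add: right_diff_distrib xy_pow_mult flip: mult.assoc)
qed (simp add: M.zero)

lemma M_cnj: "m \<in> M \<Longrightarrow> cnj m \<in> M"
proof (induction m rule: M.induct)
  case (plus m' c d)
  have "cnj (xy_pow c d * v) = xy_pow (- c + 1) (- d + 1) * v"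
    by (simp only: complex_cnj_mult cnj_xy_pow cnj_v xy_pow_simps(5)[symmetric] xy_pow_mult mult.assoc[symmetric])
  with plus show ?case using M.plus[of "cnj m'" "- c + 1" "- d + 1"] by simp
next
  case (minus m' c d)
  have "cnj (xy_pow c d * v) = xy_pow (- c + 1) (- d + 1) * v"
    by (simp only: complex_cnj_mult cnj_xy_pow cnj_v xy_pow_simps(5)[symmetric] xy_pow_mult mult.assoc[symmetric])
  with minus show ?case using M.minus[of "cnj m'" "- c + 1" "- d + 1"] by simp
qed (simp add: M.zero)

text \<open>Up to sign, \<open>(1 - x) * (1 - y)\<close> is a monomial multiple of \<open>v\<close>;
  the general case telescopes in \<open>b\<close> and then in \<open>a\<close>. Up to sign these are
  the vectors of commutators of rotations about \<open>A1\<close> and \<open>A2\<close>.\<close>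

lemma M_commutator: "(1 - xy_pow a 0) * (1 - xy_pow 0 b) \<in> M"
proof -
  have xy: "(1 - x) * (1 - y) \<in> M"
  proof -
    have "(1 - x) * (1 - y) = 0 - xy_pow 1 1 * v"
      using xy_nz by (simp add: xy_pow_simps v_def field_simps)
    then show ?thesis by (metis M.zero M.minus)
  qed
  have x: "(1 - x) * (1 - xy_pow 0 b) \<in> M"
  proof (induction b rule: int_step_induct)
    case (2 b)
    have "(1 - x) * (1 - xy_pow 0 (b + 1)) = (1 - x) * (1 - xy_pow 0 b) + xy_pow 0 b * ((1 - x) * (1 - y))"
      using xy_pow_mult[of 0 b 0 1] by (simp add: xy_pow_simps algebra_simps)
    with 2 show ?case using M_add M_xy_pow xy by presburger
  next
    case (3 b)
    have "xy_pow 0 (b - 1) * y = xy_pow 0 b" using xy_pow_mult[of 0 "b - 1" 0 1] by (simp add: xy_pow_simps)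
    then have "(1 - x) * (1 - xy_pow 0 (b - 1)) = (1 - x) * (1 - xy_pow 0 b) - xy_pow 0 (b - 1) * ((1 - x) * (1 - y))"
      by (simp add: algebra_simps)
    with 3 show ?case using M_diff M_xy_pow xy by presburger
  qed (simp add: M.zero)
  show ?thesis
  proof (induction a rule: int_step_induct)
    case (2 a)
    have "(1 - xy_pow (a + 1) 0) * (1 - xy_pow 0 b) = (1 - xy_pow a 0) * (1 - xy_pow 0 b) + xy_pow a 0 * ((1 - x) * (1 - xy_pow 0 b))"
      using xy_pow_mult[of a 0 1 0] by (simp add: xy_pow_simps algebra_simps)
    with 2 show ?case using M_add M_xy_pow x by presburger
  next
    case (3 a)
    have "xy_pow (a - 1) 0 * x = xy_pow a 0" using xy_pow_mult[of "a - 1" 0 1 0] by (simp add: xy_pow_simps)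
    then have "(1 - xy_pow (a - 1) 0) * (1 - xy_pow 0 b) = (1 - xy_pow a 0) * (1 - xy_pow 0 b) - xy_pow (a - 1) 0 * ((1 - x) * (1 - xy_pow 0 b))"
      by (simp add: algebra_simps)
    with 3 show ?case using M_diff M_xy_pow x by presburger
  qed (simp add: M.zero)
qed

text \<open>The expression is, up to sign, a monomial times
  \<open>(1 - xy_pow a 0) * (1 - xy_pow 0 d)\<close>. It is exactly the correction that appears when
  two normal forms are composed.\<close>

lemma M_cocycle: "xy_pow a b * (1 - xy_pow 0 d) + (1 - xy_pow 0 b) - (1 - xy_pow 0 (b + d)) \<in> M"
proof -
  have "xy_pow a b * (1 - xy_pow 0 d) + (1 - xy_pow 0 b) - (1 - xy_pow 0 (b + d)) = - (xy_pow 0 b * ((1 - xy_pow a 0) * (1 - xy_pow 0 d)))"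
    using xy_pow_mult[of 0 b a 0] xy_pow_mult[of 0 b 0 d] xy_pow_mult[of 0 b a d] xy_pow_mult[of a b 0 d] xy_pow_mult[of 0 d a 0]
    by (simp add: algebra_simps)
  then show ?thesis using M_uminus M_xy_pow M_commutator by presburger
qed

text \<open>Modulo \<open>M\<close>, the translation part of an element of the group depends only on its linear part:
  it is the cocycle \<open>1 - y powi b\<close>.\<close>

definition even_form where
  "even_form f a b \<longleftrightarrow> (\<exists>m\<in>M. \<forall>z. f (A1 + C * z) = A1 + C * (xy_pow a b * z + (1 - xy_pow 0 b) + m))"

definition odd_form where
  "odd_form f a b \<longleftrightarrow> (\<exists>m\<in>M. \<forall>z. f (A1 + C * z) = A1 + C * (xy_pow a b * cnj z + (1 - xy_pow 0 b) + m))"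

section \<open>Composition of normal forms\<close>

lemma even_even: "even_form f a b \<Longrightarrow> even_form g c d \<Longrightarrow> even_form (f \<circ> g) (a + c) (b + d)"
  unfolding even_form_def
proof (elim bexE)
  fix m m' assume m: "m \<in> M" "m' \<in> M" and f: "\<forall>z. f (A1 + C * z) = A1 + C * (xy_pow a b * z + (1 - xy_pow 0 b) + m)"
    and g: "\<forall>z. g (A1 + C * z) = A1 + C * (xy_pow c d * z + (1 - xy_pow 0 d) + m')"
  \<comment> \<open>The module part of \<open>g\<close> turned by the linear part of
    \<open>f\<close>, the module part of \<open>f\<close>, and the correction of
    \<open>M_cocycle\<close>.\<close>
  let ?m = "xy_pow a b * m' + m + (xy_pow a b * (1 - xy_pow 0 d) + (1 - xy_pow 0 b) - (1 - xy_pow 0 (b + d)))"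
  have "(f \<circ> g) (A1 + C * z) = A1 + C * (xy_pow (a + c) (b + d) * z + (1 - xy_pow 0 (b + d)) + ?m)" for z
    by (simp only: o_apply g f) (simp add: xy_pow_mult[symmetric] algebra_simps)
  moreover have "?m \<in> M" using m by (intro M_add M_xy_pow M_cocycle)
  ultimately show "\<exists>m\<in>M. \<forall>z. (f \<circ> g) (A1 + C * z) = A1 + C * (xy_pow (a + c) (b + d) * z + (1 - xy_pow 0 (b + d)) + m)"
    by blast
qed

lemma even_odd: "even_form f a b \<Longrightarrow> odd_form g c d \<Longrightarrow> odd_form (f \<circ> g) (a + c) (b + d)"
  unfolding even_form_def odd_form_def
proof (elim bexE)
  fix m m' assume m: "m \<in> M" "m' \<in> M" and f: "\<forall>z. f (A1 + C * z) = A1 + C * (xy_pow a b * z + (1 - xy_pow 0 b) + m)"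
    and g: "\<forall>z. g (A1 + C * z) = A1 + C * (xy_pow c d * cnj z + (1 - xy_pow 0 d) + m')"
  let ?m = "xy_pow a b * m' + m + (xy_pow a b * (1 - xy_pow 0 d) + (1 - xy_pow 0 b) - (1 - xy_pow 0 (b + d)))"
  have "(f \<circ> g) (A1 + C * z) = A1 + C * (xy_pow (a + c) (b + d) * cnj z + (1 - xy_pow 0 (b + d)) + ?m)" for z
    by (simp only: o_apply g f) (simp add: xy_pow_mult[symmetric] algebra_simps)
  moreover have "?m \<in> M" using m by (intro M_add M_xy_pow M_cocycle)
  ultimately show "\<exists>m\<in>M. \<forall>z. (f \<circ> g) (A1 + C * z) = A1 + C * (xy_pow (a + c) (b + d) * cnj z + (1 - xy_pow 0 (b + d)) + m)"
    by blast
qed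

lemma r3_odd: "odd_form (r3 A1 A2 A3) 0 0"
  unfolding odd_form_def using M.zero by (intro bexI[of _ 0]) (auto simp: r3_chart)

lemma r2_odd: "odd_form (r2 A1 A2 A3) 1 0"
  unfolding odd_form_def using M.zero by (intro bexI[of _ 0]) (auto simp: r2_chart xy_pow_simps)

text \<open>The constant \<open>1 - 1 / y\<close> of \<open>r1_chart\<close> is the cocycle value
  \<open>1 - xy_pow 0 b\<close> at \<open>b = -1\<close>.\<close>

lemma r1_odd: "odd_form (r1 A1 A2 A3) 0 (-1)"
  unfolding odd_form_def using M.zero by (intro bexI[of _ 0]) (auto simp: r1_chart xy_pow_simps)

text \<open>Since \<open>x\<close> and \<open>y\<close> have modulus 1, conjugation negates all
  exponents, in the linear part and in the cocycle alike.\<close>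

lemma even_cnj: "even_form g c d \<Longrightarrow> odd_form (r3 A1 A2 A3 \<circ> g) (- c) (- d)"
  unfolding even_form_def odd_form_def
proof (elim bexE)
  fix m' assume m: "m' \<in> M"
    and g: "\<forall>z. g (A1 + C * z) = A1 + C * (xy_pow c d * z + (1 - xy_pow 0 d) + m')"
  then show "\<exists>m\<in>M. \<forall>z. (r3 A1 A2 A3 \<circ> g) (A1 + C * z) = A1 + C * (xy_pow (- c) (- d) * cnj z + (1 - xy_pow 0 (- d)) + m)"
    by (intro bexI[of _ "cnj m'"]) (auto simp: r3_chart cnj_xy_pow M_cnj)
qed

lemma odd_cnj: "odd_form g c d \<Longrightarrow> even_form (r3 A1 A2 A3 \<circ> g) (- c) (- d)"
  unfolding even_form_def odd_form_def
proof (elim bexE)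
  fix m' assume m: "m' \<in> M"
    and g: "\<forall>z. g (A1 + C * z) = A1 + C * (xy_pow c d * cnj z + (1 - xy_pow 0 d) + m')"
  then show "\<exists>m\<in>M. \<forall>z. (r3 A1 A2 A3 \<circ> g) (A1 + C * z) = A1 + C * (xy_pow (- c) (- d) * z + (1 - xy_pow 0 (- d)) + m)"
    by (intro bexI[of _ "cnj m'"]) (auto simp: r3_chart cnj_xy_pow M_cnj)
qed

text \<open>\<open>r3\<close> is plain conjugation in the coordinate \<open>z\<close>, so the
  remaining composition laws reduce to those with an even outer map.\<close>

lemma odd_split: "odd_form f a b \<longleftrightarrow> (\<exists>f'. even_form f' a b \<and> f = f' \<circ> r3 A1 A2 A3)"
proof
  assume "odd_form f a b"
  then have "even_form (f \<circ> r3 A1 A2 A3) a b"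
    unfolding odd_form_def even_form_def by (auto simp: r3_chart)
  moreover have "f = (f \<circ> r3 A1 A2 A3) \<circ> r3 A1 A2 A3"
    by (rule chart_ext) (simp add: r3_chart)
  ultimately show "\<exists>f'. even_form f' a b \<and> f = f' \<circ> r3 A1 A2 A3" by blast
qed (auto simp: odd_form_def even_form_def r3_chart)

lemma odd_even: "odd_form f a b \<Longrightarrow> even_form g c d \<Longrightarrow> odd_form (f \<circ> g) (a - c) (b - d)"
  using even_odd[OF _ even_cnj, of _ a b g c d] unfolding odd_split[of f] by (auto simp: comp_assoc)

lemma odd_odd: "odd_form f a b \<Longrightarrow> odd_form g c d \<Longrightarrow> even_form (f \<circ> g) (a - c) (b - d)"
  using even_even[OF _ odd_cnj, of _ a b g c d] unfolding odd_split[of f] by (auto simp: comp_assoc)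

lemma G_forms: "g \<in> G \<Longrightarrow> \<exists>a b. even_form g a b \<or> odd_form g a b"
  unfolding triangle_group_def
proof (induction g rule: generate.induct)
  case one
  have "even_form id 0 0" unfolding even_form_def using M.zero by (intro bexI[of _ 0]) auto
  then show ?case unfolding one_E2 by blast
next
  case (incl h)
  then show ?case using r1_odd r2_odd r3_odd by blast
next
  case (inv h)
  then show ?case using r1_odd r2_odd r3_odd refl_invol by (metis empty_iff insert_iff)
next
  case (eng g h)
  then obtain a b c d where "even_form h a b \<or> odd_form h a b" "even_form g c d \<or> odd_form g c d"
    by blast
  \<comment> \<open>The product of \<open>g\<close> and \<open>h\<close> is
    \<open>h \<circ> g\<close>, which is why \<open>h\<close> comes first in the composition
    laws.\<close>
  then show ?case
    unfolding mult_E2 using even_even[of h a b g c d] even_odd[of h a b g c d]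
      odd_even[of h a b g c d] odd_odd[of h a b g c d] by blast
qed

text \<open>The linear part multiplies \<open>v\<close> by a monomial; in the odd case
  \<open>cnj_v\<close> contributes a further factor \<open>x * y\<close>. Together with
  \<open>inv_conj_transl\<close> this confines the conjugates of \<open>t1\<close>.\<close>

lemma forms_transl:
  assumes "even_form g a b \<or> odd_form g a b"
  shows "\<exists>a' b'. \<forall>z. g (z + C * v) = g z + C * (xy_pow a' b' * v)"
  using assms
proof
  assume "even_form g a b"
  then obtain m where g: "\<And>z. g (A1 + C * z) = A1 + C * (xy_pow a b * z + (1 - xy_pow 0 b) + m)"
    unfolding even_form_def by blast
  have "g (z + C * v) = g z + C * (xy_pow a b * v)" for z
  proof -
    have z: "z = A1 + C * ((z - A1) / C)" "z + C * v = A1 + C * ((z - A1) / C + v)"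
      using C_nz by (simp_all add: field_simps)
    have "g (A1 + C * (u + v)) = g (A1 + C * u) + C * (xy_pow a b * v)" for u
      unfolding g by (simp add: algebra_simps)
    then show ?thesis using z by metis
  qed
  then show ?thesis by blast
next
  assume "odd_form g a b"
  then obtain m where g: "\<And>z. g (A1 + C * z) = A1 + C * (xy_pow a b * cnj z + (1 - xy_pow 0 b) + m)"
    unfolding odd_form_def by blast
  have "g (z + C * v) = g z + C * (xy_pow (a + 1) (b + 1) * v)" for z
  proof -
    have z: "z = A1 + C * ((z - A1) / C)" "z + C * v = A1 + C * ((z - A1) / C + v)"
      using C_nz by (simp_all add: field_simps)
    have "xy_pow a b * cnj v = xy_pow (a + 1) (b + 1) * v"
      by (simp add: cnj_v xy_pow_simps flip: xy_pow_mult)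
    then have "g (A1 + C * (u + v)) = g (A1 + C * u) + C * (xy_pow (a + 1) (b + 1) * v)" for u
      unfolding g by (simp add: algebra_simps)
    then show ?thesis using z by metis
  qed
  then show ?thesis by blast
qed

section \<open>The conjugacy class of \<open>t1\<close>\<close>

lemma G_carrier: "g \<in> G \<Longrightarrow> g \<in> carrier E2"
  by (rule subgroup.mem_carrier[OF G_subgroup])

lemma B_conj:
  assumes "f \<in> B" "g \<in> G"
  shows "inv\<^bsub>E2\<^esub> g \<otimes>\<^bsub>E2\<^esub> f \<otimes>\<^bsub>E2\<^esub> g \<in> B"
proof -
  obtain h where h: "h \<in> G" "f = inv\<^bsub>E2\<^esub> h \<otimes>\<^bsub>E2\<^esub> t1 A1 A2 A3 \<otimes>\<^bsub>E2\<^esub> h"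
    using assms(1) unfolding conj_class_def by blast
  have "inv\<^bsub>E2\<^esub> g \<otimes>\<^bsub>E2\<^esub> f \<otimes>\<^bsub>E2\<^esub> g = inv\<^bsub>E2\<^esub> (h \<otimes>\<^bsub>E2\<^esub> g) \<otimes>\<^bsub>E2\<^esub> t1 A1 A2 A3 \<otimes>\<^bsub>E2\<^esub> (h \<otimes>\<^bsub>E2\<^esub> g)"
    using h assms(2) G_carrier t1_eq transl_carrier by (simp add: E2.inv_mult_group E2.m_assoc)
  moreover have "h \<otimes>\<^bsub>E2\<^esub> g \<in> G" by (rule subgroup.m_closed[OF G_subgroup h(1) assms(2)])
  ultimately show ?thesis unfolding conj_class_def by blast
qed

lemma refl_mult:
  assumes "transl (C * c) \<in> B"
  shows "transl (C * cnj c) \<in> B" "transl (C * (x * cnj c)) \<in> B" "transl (C * (1 / y * cnj c)) \<in> B"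
proof -
  \<comment> \<open>Conjugation by an orientation-reversing map with coefficient \<open>u\<close>;
    its constant \<open>m\<close> cancels.\<close>
  have *: "transl (C * (u * cnj c)) \<in> B"
    if r: "r \<in> G" "\<And>z. r (A1 + C * z) = A1 + C * (u * cnj z + m)" for r u m
  proof -
    have "r (z + C * c) = r z + C * (u * cnj c)" for z
    proof -
      have z: "z = A1 + C * ((z - A1) / C)" "z + C * c = A1 + C * ((z - A1) / C + c)"
        using C_nz by (simp_all add: field_simps)
      have "r (A1 + C * (s + c)) = r (A1 + C * s) + C * (u * cnj c)" for s
        unfolding r by (simp add: algebra_simps)
      then show ?thesis using z by metis
    qed
    then show ?thesis using B_conj[OF assms r(1)] inv_conj_transl G_carrier[OF r(1)] by metis
  qed
  show "transl (C * cnj c) \<in> B" using *[OF refl_in_G(3), of 1 0] by (simp add: r3_chart)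
  show "transl (C * (x * cnj c)) \<in> B" using *[OF refl_in_G(2), of x 0] by (simp add: r2_chart)
  show "transl (C * (1 / y * cnj c)) \<in> B" using *[OF refl_in_G(1), of "1 / y" "1 - 1 / y"]
    by (simp add: r1_chart add_diff_eq)
qed

text \<open>Conjugating by two reflections in succession undoes the complex conjugation and leaves
  multiplication by a rotation factor.\<close>

lemma B_mult:
  assumes "transl (C * c) \<in> B"
  shows "transl (C * (x * c)) \<in> B" "transl (C * (1 / x * c)) \<in> B"
    "transl (C * (y * c)) \<in> B" "transl (C * (1 / y * c)) \<in> B"
proof -
  note r = refl_mult[OF assms]
  show "transl (C * (x * c)) \<in> B" "transl (C * (1 / y * c)) \<in> B"
    using refl_mult(2,3)[OF r(1)] by simp_all
  show "transl (C * (1 / x * c)) \<in> B" "transl (C * (y * c)) \<in> B"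
    using refl_mult(1)[OF r(2)] refl_mult(1)[OF r(3)] by (simp_all add: cnj_xy mult.commute)
qed

text \<open>Normal forms confine the conjugates to monomial multiples of \<open>v\<close>;
  conversely, every monomial is reached from \<open>v\<close> by unit steps in the exponents, each
  realised by \<open>B_mult\<close>.\<close>

lemma B_eq: "B = range (\<lambda>(a, b). transl (C * (xy_pow a b * v)))"
proof
  show "B \<subseteq> range (\<lambda>(a, b). transl (C * (xy_pow a b * v)))"
  proof
    fix f assume "f \<in> B"
    then obtain g where g: "g \<in> G" "f = inv\<^bsub>E2\<^esub> g \<otimes>\<^bsub>E2\<^esub> transl (C * v) \<otimes>\<^bsub>E2\<^esub> g"
      unfolding conj_class_def t1_eq by blast
    obtain a b where "\<forall>z. g (z + C * v) = g z + C * (xy_pow a b * v)"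
      using G_forms[OF g(1)] forms_transl by blast
    then have "f = transl (C * (xy_pow a b * v))"
      unfolding g(2) using inv_conj_transl G_carrier[OF g(1)] by blast
    then show "f \<in> range (\<lambda>(a, b). transl (C * (xy_pow a b * v)))" by auto
  qed
  have 0: "transl (C * v) \<in> B"
  proof -
    have "inv\<^bsub>E2\<^esub> \<one>\<^bsub>E2\<^esub> \<otimes>\<^bsub>E2\<^esub> t1 A1 A2 A3 \<otimes>\<^bsub>E2\<^esub> \<one>\<^bsub>E2\<^esub> \<in> B"
      unfolding conj_class_def using subgroup.one_closed[OF G_subgroup] by blast
    then show ?thesis by (simp add: t1_eq transl_carrier)
  qed
  have step: "xy_pow (a + 1) b = x * xy_pow a b" "xy_pow (a - 1) b = 1 / x * xy_pow a b"
    "xy_pow a (b + 1) = y * xy_pow a b" "xy_pow a (b - 1) = 1 / y * xy_pow a b" for a b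
    using xy_nz by (simp_all add: xy_pow_def power_int_add power_int_diff)
  have row: "transl (C * (xy_pow a 0 * v)) \<in> B" for a
  proof (induction a rule: int_step_induct)
    case 1 show ?case using 0 by simp
  next
    case (2 a) then show ?case using B_mult(1) by (simp only: step mult.assoc)
  next
    case (3 a) then show ?case using B_mult(2) by (simp only: step mult.assoc)
  qed
  have "transl (C * (xy_pow a b * v)) \<in> B" for a b
  proof (induction b rule: int_step_induct)
    case 1 show ?case using row by simp
  next
    case (2 a) then show ?case using B_mult(3) by (simp only: step mult.assoc)
  next
    case (3 a) then show ?case using B_mult(4) by (simp only: step mult.assoc)
  qed
  then show "range (\<lambda>(a, b). transl (C * (xy_pow a b * v))) \<subseteq> B" by auto
qed

lemma B_carrier: "B \<subseteq> carrier E2"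
  using transl_carrier by (auto simp: B_eq)

section \<open>The normal closure of \<open>t1\<close> and the translation subgroup\<close>

lemma t1_in_G: "t1 A1 A2 A3 \<in> G"
proof -
  have "r1 A1 A2 A3 \<otimes>\<^bsub>E2\<^esub> r2 A1 A2 A3 \<otimes>\<^bsub>E2\<^esub> r3 A1 A2 A3 \<in> G" (is "?g \<in> G")
    using refl_in_G subgroup.m_closed[OF G_subgroup] by blast
  moreover have "t1 A1 A2 A3 = ?g \<otimes>\<^bsub>E2\<^esub> ?g"
    using refl_carrier by (simp add: t1_def numeral_2_eq_2)
  ultimately show ?thesis using subgroup.m_closed[OF G_subgroup] by metis
qed

lemma closure_subset: "normal_closure G (t1 A1 A2 A3) \<subseteq> T"
proof
  have "B \<subseteq> G"
    using t1_in_G subgroup.m_closed[OF G_subgroup] subgroup.m_inv_closed[OF G_subgroup]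
    unfolding conj_class_def by blast
  then have sub: "generate E2 B \<subseteq> G" using E2.generate_subgroup_incl G_subgroup by blast
  fix f assume f: "f \<in> normal_closure G (t1 A1 A2 A3)"
  then have "\<exists>c. f = transl c"
    unfolding normal_closure_def
  proof (induction f rule: generate.induct)
    case one
    show ?case by (rule exI[of _ 0]) (simp add: one_E2 transl_0)
  next
    case (incl h)
    then show ?case by (auto simp: B_eq)
  next
    case (inv h)
    then show ?case by (auto simp: B_eq transl_inv)
  next
    case (eng h k)
    then show ?case by (metis transl_mult)
  qed
  with f sub show "f \<in> T"
    unfolding translation_subgroup_def is_translation_iff normal_closure_def by auto
qed

lemma transl_M_closure: "m \<in> M \<Longrightarrow> transl (C * m) \<in> normal_closure G (t1 A1 A2 A3)"
  unfolding normal_closure_def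
proof (induction m rule: M.induct)
  case zero
  show ?case using generate.one[of E2 B] unfolding mult_zero_right transl_0 one_E2 .
next
  case (plus m a b)
  have "transl (C * (xy_pow a b * v)) \<in> generate E2 B" by (rule generate.incl) (auto simp: B_eq)
  from generate.eng[OF plus.IH this] show ?case by (simp add: transl_mult distrib_left)
next
  case (minus m a b)
  have "inv\<^bsub>E2\<^esub> (transl (C * (xy_pow a b * v))) \<in> generate E2 B" by (rule generate.inv) (auto simp: B_eq)
  from generate.eng[OF minus.IH this] show ?case by (simp add: transl_inv transl_mult right_diff_distrib)
qed

text \<open>A translation has linear part 1, so independence forces \<open>b = 0\<close>; the
  cocycle value \<open>1 - xy_pow 0 b\<close> then vanishes and only the module part is
  left.\<close>

lemma T_transl_M:
  assumes indep: "\<And>a b. xy_pow a b = 1 \<Longrightarrow> a = 0 \<and> b = 0" and "f \<in> T"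
  shows "\<exists>m\<in>M. f = transl (C * m)"
proof -
  obtain c where c: "f = transl c" and "f \<in> G"
    using assms(2) unfolding translation_subgroup_def is_translation_iff by blast
  then obtain a b where "even_form f a b \<or> odd_form f a b" using G_forms by blast
  then show ?thesis
  proof
    assume "even_form f a b"
    then obtain m where m: "m \<in> M" and f: "\<And>z. f (A1 + C * z) = A1 + C * (xy_pow a b * z + (1 - xy_pow 0 b) + m)"
      unfolding even_form_def by blast
    have "c = C * (1 - xy_pow 0 b + m)" using f[of 0] c by (simp add: transl_def algebra_simps)
    moreover from this f[of 1] c C_nz have "C * xy_pow a b = C * 1" by (simp add: transl_def algebra_simps)
    then have "xy_pow a b = 1" using C_nz by simp
    then have "b = 0" using indep by blast
    ultimately have "f = transl (C * m)" using c by simp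
    with m show ?thesis by blast
  next
    assume "odd_form f a b"
    then obtain m where f: "\<And>z. f (A1 + C * z) = A1 + C * (xy_pow a b * cnj z + (1 - xy_pow 0 b) + m)"
      unfolding odd_form_def by blast
    have c': "c = C * (1 - xy_pow 0 b + m)" using f[of 0] c by (simp add: transl_def algebra_simps)
    with f[of 1] c have "C * xy_pow a b = C * 1" by (simp add: transl_def algebra_simps)
    then have "xy_pow a b = 1" using C_nz by simp
    \<comment> \<open>The map would conjugate and translate at once; comparing values at
      \<open>\<i>\<close> makes \<open>C * (2 * \<i>)\<close> zero.\<close>
    with f[of \<i>] c c' have "C * (2 * \<i>) = 0" by (simp add: transl_def algebra_simps)
    then show ?thesis using C_nz by simp
  qed
qed

lemma T_eq_closure:
  assumes "\<And>a b. xy_pow a b = 1 \<Longrightarrow> a = 0 \<and> b = 0"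
  shows "T = normal_closure G (t1 A1 A2 A3)"
proof
  show "T \<subseteq> normal_closure G (t1 A1 A2 A3)"
    using T_transl_M[OF assms] transl_M_closure by fast
qed (rule closure_subset)

section \<open>Typical triangles\<close>

lemma edges: "A2 - A1 = C" "A3 - A1 = C * w" "A3 - A2 = C * (w - 1)"
proof -
  show "A2 - A1 = C" "A3 - A1 = C * w" using C_nz by (simp_all add: C_def w_def)
  moreover have "A3 - A2 = (A3 - A1) - (A2 - A1)" by simp
  ultimately show "A3 - A2 = C * (w - 1)" by (simp only: right_diff_distrib mult_1_right)
qed

lemma typical_independent:
  assumes "typical_triangle A1 A2 A3" "xy_pow a b = 1"
  shows "a = 0 \<and> b = 0"
proof -
  \<comment> \<open>The orientation of the triangle: the angles are unsigned, the rotations are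
    not.\<close>
  define \<sigma> where "\<sigma> = sgn (Im w)"
  have \<sigma>: "\<sigma> \<noteq> 0" "\<sigma> * \<sigma> = 1" using Im_w by (auto simp: \<sigma>_def sgn_if)
  let ?a1 = "ang1 A1 A2 A3" and ?a2 = "ang2 A1 A2 A3" and ?a3 = "ang3 A1 A2 A3"
  note d = edges
  have q1: "(A3 - A1) / (A2 - A1) = w"
    using C_nz by (simp add: d)
  have q2: "(A1 - A2) / (A3 - A2) = 1 / (1 - w)"
  proof -
    have "A1 - A2 = - C" using d(1) by (simp add: algebra_simps)
    then show ?thesis using C_nz w_nz by (simp add: d(3) divide_simps)
  qed
  have q3: "(A2 - A3) / (A1 - A3) = 1 - 1 / w"
  proof -
    have "A2 - A3 = - (C * (w - 1))" "A1 - A3 = - (C * w)"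
      using d(2,3) by (metis minus_diff_eq)+
    then show ?thesis using C_nz w_nz by (simp add: divide_simps)
  qed
  have im2: "Im (1 / (1 - w)) = Im w / (norm (1 - w))\<^sup>2"
    by (simp add: Im_divide cmod_power2)
  have im3: "Im (1 - 1 / w) = Im w / (norm w)\<^sup>2"
    by (simp add: Im_divide cmod_power2)
  have s2: "sgn (Im (1 / (1 - w))) = \<sigma>" and s3: "sgn (Im (1 - 1 / w)) = \<sigma>"
    unfolding im2 im3 \<sigma>_def sgn_divide using w_nz by simp_all
  have c1: "cis (\<sigma> * ?a1) = sgn w"
    using vertex_angle_cis[of A3 A1 A2] Im_w unfolding q1 ang1_def \<sigma>_def by blast
  have c2: "cis (\<sigma> * ?a2) = sgn (1 / (1 - w))"
    using vertex_angle_cis[of A1 A2 A3] s2 \<sigma> unfolding q2 ang2_def by (metis sgn_zero)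
  have c3: "cis (\<sigma> * ?a3) = sgn (1 - 1 / w)"
    using vertex_angle_cis[of A2 A3 A1] s3 \<sigma> unfolding q3 ang3_def by (metis sgn_zero)
  \<comment> \<open>The three side ratios multiply to -1, so the signed angles sum to an odd
    multiple of \<open>pi\<close>; oddness keeps \<open>2 * j + 1\<close> from vanishing at the
    end.\<close>
  have "w * (1 / (1 - w)) * (1 - 1 / w) = - 1"
    using w_nz by (simp add: divide_simps)
  then have "sgn w * sgn (1 / (1 - w)) * sgn (1 - 1 / w) = sgn (- 1)"
    by (simp only: sgn_mult[symmetric])
  then have "cis (\<sigma> * ?a1) * cis (\<sigma> * ?a2) * cis (\<sigma> * ?a3) = - 1"
    unfolding c1 c2 c3 by (simp add: sgn_minus)
  then have "cis (\<sigma> * (?a1 + ?a2 + ?a3) - pi) = 1"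
    by (simp add: cis_mult distrib_left flip: cis_divide)
  then obtain j :: int where "\<sigma> * (?a1 + ?a2 + ?a3) - pi = of_int j * 2 * pi"
    by (metis cos_one_2pi_int cis.sel(1) one_complex.sel(1))
  then have j: "\<sigma> * (?a1 + ?a2 + ?a3) = of_int (2 * j + 1) * pi" by (simp add: algebra_simps)
  have xy: "x = cis (\<sigma> * ?a1) ^ 2" "y = cis (\<sigma> * ?a2) ^ 2"
    unfolding c1 c2 sgn_power2_complex x_def y_def by (simp_all add: divide_simps)
  have "xy_pow a b = cis (2 * (\<sigma> * (of_int a * ?a1 + of_int b * ?a2)))"
    unfolding xy_pow_def xy Complex.DeMoivre cis_power_int cis_mult by (simp add: algebra_simps)
  with assms(2) obtain n :: int where "2 * (\<sigma> * (of_int a * ?a1 + of_int b * ?a2)) = of_int n * 2 * pi"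
    by (metis cos_one_2pi_int cis.sel(1) one_complex.sel(1))
  then have n: "\<sigma> * (of_int a * ?a1 + of_int b * ?a2) = of_int n * pi" by simp
  \<comment> \<open>Cross-multiplying eliminates \<open>pi\<close> and leaves an integral relation
    between the angles. The third angle has coefficient \<open>- n\<close>, so
    \<open>n = 0\<close>.\<close>
  have "of_int (2 * j + 1) * (\<sigma> * (of_int a * ?a1 + of_int b * ?a2)) = of_int n * (\<sigma> * (?a1 + ?a2 + ?a3))"
    unfolding n j by simp
  then have "\<sigma> * (of_int (2 * j + 1) * (of_int a * ?a1 + of_int b * ?a2) - of_int n * (?a1 + ?a2 + ?a3)) = 0"
    by (simp add: algebra_simps)
  then have "of_int (2 * j + 1) * (of_int a * ?a1 + of_int b * ?a2) - of_int n * (?a1 + ?a2 + ?a3) = 0"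
    using \<sigma> by simp
  then have "of_int ((2 * j + 1) * a - n) * ?a1 + of_int ((2 * j + 1) * b - n) * ?a2 + of_int (- n) * ?a3 = 0"
    by (simp add: algebra_simps)
  then have "of_int ((2 * j + 1) * a - n) = (0 :: real) \<and> of_int ((2 * j + 1) * b - n) = (0 :: real) \<and> of_int (- n) = (0 :: real)"
    using assms(1)[unfolded typical_triangle_def, rule_format, OF Rats_of_int Rats_of_int Rats_of_int] by blast
  then have "(2 * j + 1) * a - n = 0 \<and> (2 * j + 1) * b - n = 0 \<and> - n = 0"
    unfolding of_int_eq_0_iff .
  then have "(2 * j + 1) * a = 0 \<and> (2 * j + 1) * b = 0" by simp
  moreover have "2 * j + 1 \<noteq> 0" by presburger
  ultimately show ?thesis by simp
qed

section \<open>Generic triangles and linear independence of the monomials\<close>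

definition laurent_free :: bool where
  "laurent_free \<longleftrightarrow> (\<forall>S k. finite S \<longrightarrow> (\<Sum>(m, n)\<in>S. of_int (k (m, n)) * xy_pow m n) = 0 \<longrightarrow> (\<forall>e\<in>S. k e = (0 :: int)))"

text \<open>The scaled sides are \<open>a\<close>, \<open>b\<close>, \<open>s\<close>, and the law
  of cosines identifies \<open>x\<close> and \<open>y\<close> with the quotients of
  \<open>laurent_independent\<close>.\<close>

lemma generic_laurent_free:
  assumes "generic_triangle A1 A2 A3"
  shows laurent_free
proof -
  obtain k where "k > 0" and indep: "alg_indep3 (k * len1 A1 A2 A3) (k * len2 A1 A2 A3) (k * len3 A1 A2 A3)"
    using assms unfolding generic_triangle_def by blast
  define s where "s = k * norm C"
  have s: "s > 0" using \<open>k > 0\<close> C_nz by (simp add: s_def)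
  have "len1 A1 A2 A3 = norm C * norm (1 - w)" "len2 A1 A2 A3 = norm C * norm w" "len3 A1 A2 A3 = norm C"
    unfolding len1_def len2_def len3_def dist_norm
    by (metis edges norm_minus_commute norm_mult)+
  then have lens: "k * len1 A1 A2 A3 = s * norm (1 - w)" "k * len2 A1 A2 A3 = s * norm w" "k * len3 A1 A2 A3 = s"
    by (simp_all add: s_def)
  define a where "a = s * norm (1 - w)"
  define b where "b = s * norm w"
  \<comment> \<open>Four times the signed area of the scaled triangle, hence a square root of
    \<open>heron a b s\<close>.\<close>
  define d where "d = 2 * s\<^sup>2 * Im w"
  have pos: "a > 0" "b > 0" using s w_nz by (simp_all add: a_def b_def)
  have d_nz: "d \<noteq> 0" using s Im_w by (simp add: d_def)
  have sq: "a\<^sup>2 = s\<^sup>2 * ((1 - Re w)\<^sup>2 + (Im w)\<^sup>2)" "b\<^sup>2 = s\<^sup>2 * ((Re w)\<^sup>2 + (Im w)\<^sup>2)"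
    by (simp_all add: a_def b_def power_mult_distrib cmod_power2)
  have re: "b\<^sup>2 + s\<^sup>2 - a\<^sup>2 = 2 * s\<^sup>2 * Re w" "a\<^sup>2 + s\<^sup>2 - b\<^sup>2 = 2 * s\<^sup>2 * (1 - Re w)"
    unfolding sq by (simp_all add: algebra_simps power2_eq_square)
  have "heron a b s = 4 * b\<^sup>2 * s\<^sup>2 - (b\<^sup>2 + s\<^sup>2 - a\<^sup>2)\<^sup>2"
    unfolding heron_def by (simp add: algebra_simps power2_eq_square power4_eq_xxxx)
  also have "\<dots> = d\<^sup>2"
    unfolding re(1) unfolding sq(2) d_def by (simp add: algebra_simps power2_eq_square)
  finally have d2: "d\<^sup>2 = heron a b s" ..
  have cx: "Complex (b\<^sup>2 + s\<^sup>2 - a\<^sup>2) d = of_real (2 * s\<^sup>2) * w"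
    "Complex (a\<^sup>2 + s\<^sup>2 - b\<^sup>2) d = of_real (2 * s\<^sup>2) * cnj (1 - w)"
    unfolding re by (simp_all add: complex_eq_iff d_def)
  \<comment> \<open>Squaring and dividing by the squared modulus leaves only the rotation by twice
    the argument of \<open>z\<close>.\<close>
  have quot: "(of_real (2 * s\<^sup>2) * z)\<^sup>2 / of_real ((2 * (s * norm z) * s)\<^sup>2) = z / cnj z" if "z \<noteq> 0" for z
  proof -
    have "complex_of_real ((2 * (s * norm z) * s)\<^sup>2) = of_real ((2 * s\<^sup>2)\<^sup>2) * of_real ((norm z)\<^sup>2)"
      unfolding of_real_mult[symmetric] by (simp add: power_mult_distrib power2_eq_square)
    also have "\<dots> = (of_real (2 * s\<^sup>2))\<^sup>2 * (z * cnj z)"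
      by (simp only: complex_norm_square) (simp only: of_real_power)
    finally show ?thesis using s that
      by (simp only: power_mult_distrib) (simp add: power2_eq_square)
  qed
  have x: "x = (Complex (b\<^sup>2 + s\<^sup>2 - a\<^sup>2) d)\<^sup>2 / of_real ((2 * b * s)\<^sup>2)"
    unfolding cx unfolding b_def by (simp only: quot[OF w_nz(1)] x_def)
  have y: "y = (Complex (a\<^sup>2 + s\<^sup>2 - b\<^sup>2) d)\<^sup>2 / of_real ((2 * a * s)\<^sup>2)"
  proof -
    have "cnj (1 - w) \<noteq> 0" using w_nz(3) by (simp only: complex_cnj_zero_iff not_False_eq_True)
    from quot[OF this] show ?thesis
      unfolding cx unfolding a_def complex_mod_cnj complex_cnj_cnj by (simp only: y_def)
  qed
  show ?thesis
    unfolding laurent_free_def xy_pow_def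
    using laurent_independent[OF indep[unfolded lens, folded a_def b_def] d2 d_nz pos s] unfolding x[symmetric] y[symmetric]
    by blast
qed

lemma laurent_free_independent:
  assumes laurent_free "xy_pow a b = 1"
  shows "a = 0 \<and> b = 0"
proof (rule ccontr)
  assume ne: "\<not> (a = 0 \<and> b = 0)"
  \<comment> \<open>Coefficients of the relation \<open>xy_pow a b - 1 = 0\<close>.\<close>
  define k where "k e = (if e = (a, b) then 1 else - 1 :: int)" for e
  have "(\<Sum>(m, n)\<in>{(a, b), (0, 0)}. of_int (k (m, n)) * xy_pow m n) = 0"
    using ne assms(2) by (auto simp: k_def)
  then have "k (a, b) = 0"
    by (rule assms(1)[unfolded laurent_free_def, rule_format, rotated]) simp_all
  then show False by (simp add: k_def)
qed

section \<open>The basis of the translation subgroup\<close>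

definition basis_elem :: "int \<times> int \<Rightarrow> complex \<Rightarrow> complex" where
  "basis_elem e = transl (C * (xy_pow (fst e) (snd e) * v))"

lemma B_eq_range: "B = range basis_elem"
  unfolding B_eq by (simp add: basis_elem_def[abs_def] case_prod_unfold)

lemma basis_elem_0: "basis_elem e 0 = C * (xy_pow (fst e) (snd e) * v)"
  by (simp add: basis_elem_def transl_def)

lemma inj_basis_elem:
  assumes laurent_free
  shows "inj basis_elem"
proof (rule injI)
  fix e e' assume "basis_elem e = basis_elem e'"
  then have eq: "xy_pow (fst e) (snd e) = xy_pow (fst e') (snd e')"
    unfolding basis_elem_def transl_inject using C_nz v_nz by simp
  have "xy_pow (fst e - fst e') (snd e - snd e') = xy_pow (fst e) (snd e) * xy_pow (- fst e') (- snd e')"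
    by (simp add: xy_pow_mult)
  also have "\<dots> = 1" unfolding eq by (simp add: xy_pow_mult)
  finally have "fst e - fst e' = 0 \<and> snd e - snd e' = 0" by (rule laurent_free_independent[OF assms])
  then show "e = e'" by (simp add: prod_eq_iff)
qed

text \<open>A translation \<open>b\<close> has vector \<open>b 0\<close>, so for finitely supported
  \<open>n\<close> on \<open>B\<close> this is the vector of the product of the powers of
  \<open>b\<close> with exponents \<open>n b\<close>. Identities in the group become linear
  relations over the integers.\<close>

definition val :: "((complex \<Rightarrow> complex) \<Rightarrow> int) \<Rightarrow> complex" where
  "val n = (\<Sum>b\<in>{b. n b \<noteq> 0}. of_int (n b) * b 0)"

lemma val_superset:
  assumes "finite S" "{b. n b \<noteq> 0} \<subseteq> S"
  shows "val n = (\<Sum>b\<in>S. of_int (n b) * b 0)"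
  unfolding val_def using assms by (intro sum.mono_neutral_left) auto

lemma val_update:
  assumes "finite {b. n b \<noteq> 0}"
  shows "val (n(p := n p + e)) = val n + of_int e * p 0"
proof -
  let ?S = "insert p {b. n b \<noteq> 0}"
  have "val (n(p := n p + e)) = (\<Sum>b\<in>?S. of_int ((n(p := n p + e)) b) * b 0)"
    using assms by (intro val_superset) auto
  also have "\<dots> = (\<Sum>b\<in>?S. of_int (n b) * b 0 + (if b = p then of_int e * p 0 else 0))"
    by (intro sum.cong) (auto simp: algebra_simps)
  also have "\<dots> = (\<Sum>b\<in>?S. of_int (n b) * b 0) + of_int e * p 0"
    using assms by (simp only: sum.distrib) simp
  also have "(\<Sum>b\<in>?S. of_int (n b) * b 0) = val n"
    using assms by (intro val_superset[symmetric]) auto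
  finally show ?thesis .
qed

lemma finprod_val:
  assumes "finite {b. n b \<noteq> 0}" "{b. n b \<noteq> 0} \<subseteq> B"
  shows "finprod E2 (\<lambda>b. b [^]\<^bsub>E2\<^esub> n b) {b. n b \<noteq> 0} = transl (val n)"
  unfolding val_def
proof (rule finprod_transl[OF assms(1)])
  fix b assume "b \<in> {b. n b \<noteq> 0}"
  with assms(2) obtain e where b: "b = basis_elem e" unfolding B_eq_range by blast
  show "b [^]\<^bsub>E2\<^esub> n b = transl (of_int (n b) * b 0)"
    unfolding b basis_elem_0 by (simp add: basis_elem_def transl_int_pow)
qed

text \<open>Each generation step of \<open>M\<close> changes a single coefficient by 1 or -1, namely
  the one at the translation by the added generator.\<close>

lemma M_val:
  assumes "m \<in> M"
  shows "\<exists>n. finite {b. n b \<noteq> 0} \<and> {b. n b \<noteq> 0} \<subseteq> B \<and> C * m = val n"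
proof -
  have step: "\<exists>n'. finite {b. n' b \<noteq> 0} \<and> {b. n' b \<noteq> 0} \<subseteq> B \<and> val n + of_int e * (C * (xy_pow c d * v)) = val n'"
    if "finite {b. n b \<noteq> 0}" "{b. n b \<noteq> 0} \<subseteq> B" for n e c d
  proof (intro exI conjI)
    let ?p = "basis_elem (c, d)"
    have sub: "{b. (n(?p := n ?p + e)) b \<noteq> 0} \<subseteq> insert ?p {b. n b \<noteq> 0}" by auto
    then show "finite {b. (n(?p := n ?p + e)) b \<noteq> 0}"
      by (rule finite_subset) (use that(1) in simp)
    show "{b. (n(?p := n ?p + e)) b \<noteq> 0} \<subseteq> B"
      using sub that(2) B_eq_range by blast
    show "val n + of_int e * (C * (xy_pow c d * v)) = val (n(?p := n ?p + e))"
      using val_update[OF that(1), of ?p e] by (simp add: basis_elem_0)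
  qed
  show ?thesis using assms
  proof induction
    case zero
    show ?case by (rule exI[of _ "\<lambda>b. 0"]) (simp add: val_def)
  next
    case (plus m c d)
    then obtain n where "finite {b. n b \<noteq> 0}" "{b. n b \<noteq> 0} \<subseteq> B" "C * m = val n" by blast
    with step[of n 1 c d] show ?case by (simp add: distrib_left)
  next
    case (minus m c d)
    then obtain n where "finite {b. n b \<noteq> 0}" "{b. n b \<noteq> 0} \<subseteq> B" "C * m = val n" by blast
    with step[of n "-1" c d] show ?case by (simp add: right_diff_distrib)
  qed
qed

text \<open>Injectivity of \<open>basis_elem\<close> lets the difference of \<open>n\<close> and
  \<open>n'\<close> be indexed by exponent pairs; dividing by \<open>C * v\<close> turns it into a
  Laurent relation.\<close>

lemma val_inject:
  assumes laurent_free
    and n: "finite {b. n b \<noteq> 0}" "{b. n b \<noteq> 0} \<subseteq> B"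
    and n': "finite {b. n' b \<noteq> 0}" "{b. n' b \<noteq> 0} \<subseteq> B"
    and "val n = val n'"
  shows "n = n'"
proof -
  let ?S = "{b. n b \<noteq> 0} \<union> {b. n' b \<noteq> 0}"
  define I where "I = basis_elem -` ?S"
  have S: "?S = basis_elem ` I"
    unfolding I_def image_vimage_eq using n(2) n'(2) B_eq_range by blast
  have fin: "finite I"
    unfolding I_def using n(1) n'(1) inj_basis_elem[OF assms(1)] by (intro finite_vimageI) auto
  have inj: "inj_on basis_elem I"
    using inj_basis_elem[OF assms(1)] by (rule inj_on_subset) simp
  define k where "k e = n (basis_elem e) - n' (basis_elem e)" for e
  have "val n = (\<Sum>b\<in>?S. of_int (n b) * b 0)" "val n' = (\<Sum>b\<in>?S. of_int (n' b) * b 0)"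
    using n(1) n'(1) by (intro val_superset; auto)+
  then have "0 = (\<Sum>b\<in>?S. of_int (n b - n' b) * b 0)"
    using assms(6) by (simp add: left_diff_distrib sum_subtractf)
  also have "\<dots> = (\<Sum>e\<in>I. of_int (k e) * (C * (xy_pow (fst e) (snd e) * v)))"
    unfolding S sum.reindex[OF inj] by (simp add: k_def basis_elem_0)
  also have "\<dots> = C * v * (\<Sum>(a, b)\<in>I. of_int (k (a, b)) * xy_pow a b)"
    by (simp add: sum_distrib_left case_prod_unfold mult_ac)
  finally have "(\<Sum>(a, b)\<in>I. of_int (k (a, b)) * xy_pow a b) = 0"
    using C_nz v_nz by simp
  then have "\<forall>e\<in>I. k e = 0" using assms(1)[unfolded laurent_free_def] fin by blast
  then have "\<forall>b\<in>?S. n b = n' b" unfolding S by (simp add: k_def)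
  then have agree: "n b = n' b" if "b \<in> ?S" for b using that by blast
  show ?thesis
  proof
    fix b
    show "n b = n' b"
    proof (cases "b \<in> ?S")
      case False
      then have "n b = 0" "n' b = 0" by simp_all
      then show ?thesis by simp
    qed (rule agree)
  qed
qed

text \<open>Existence of the coefficients is \<open>M_val\<close> and uniqueness is
  \<open>val_inject\<close>; \<open>finprod_val\<close> passes between products of translations and
  sums of vectors.\<close>

lemma free_abelian:
  assumes laurent_free
  shows "free_abelian_basis E2 T B"
  unfolding free_abelian_basis_def
proof (intro conjI ballI)
  have T: "T = generate E2 B"
    using T_eq_closure[OF laurent_free_independent[OF assms]] by (simp add: normal_closure_def)
  have "subgroup T E2" unfolding T by (rule E2.generate_is_subgroup[OF B_carrier])
  then have "group (E2\<lparr>carrier := T\<rparr>)" by (rule E2.subgroup_imp_group)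
  then show "comm_group (E2\<lparr>carrier := T\<rparr>)"
  proof (rule group.group_comm_groupI)
    fix f g assume "f \<in> carrier (E2\<lparr>carrier := T\<rparr>)" "g \<in> carrier (E2\<lparr>carrier := T\<rparr>)"
    then obtain c d where "f = transl c" "g = transl d"
      by (auto simp: translation_subgroup_def is_translation_iff)
    then show "f \<otimes>\<^bsub>E2\<lparr>carrier := T\<rparr>\<^esub> g = g \<otimes>\<^bsub>E2\<lparr>carrier := T\<rparr>\<^esub> f"
      by (simp add: transl_mult add.commute)
  qed
  show "B \<subseteq> T" unfolding T by (intro subsetI generate.incl)
  fix f assume "f \<in> T"
  then obtain m where m: "m \<in> M" and f: "f = transl (C * m)"
    using T_transl_M[OF laurent_free_independent[OF assms]] by blast
  obtain n where n: "finite {b. n b \<noteq> 0}" "{b. n b \<noteq> 0} \<subseteq> B" "C * m = val n"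
    using M_val[OF m] by blast
  show "\<exists>!n :: _ \<Rightarrow> int. finite {b. n b \<noteq> 0} \<and> {b. n b \<noteq> 0} \<subseteq> B \<and>
      f = finprod E2 (\<lambda>b. b [^]\<^bsub>E2\<^esub> n b) {b. n b \<noteq> 0}"
  proof (rule ex1I[of _ n])
    show "finite {b. n b \<noteq> 0} \<and> {b. n b \<noteq> 0} \<subseteq> B \<and>
      f = finprod E2 (\<lambda>b. b [^]\<^bsub>E2\<^esub> n b) {b. n b \<noteq> 0}"
      unfolding finprod_val[OF n(1,2)] f n(3) using n(1,2) by blast
    fix n' :: "_ \<Rightarrow> int" assume n': "finite {b. n' b \<noteq> 0} \<and> {b. n' b \<noteq> 0} \<subseteq> B \<and>
      f = finprod E2 (\<lambda>b. b [^]\<^bsub>E2\<^esub> n' b) {b. n' b \<noteq> 0}"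
    then have fin': "finite {b. n' b \<noteq> 0}" "{b. n' b \<noteq> 0} \<subseteq> B"
      and eq: "f = finprod E2 (\<lambda>b. b [^]\<^bsub>E2\<^esub> n' b) {b. n' b \<noteq> 0}" by blast+
    have "val n' = val n"
      using eq unfolding finprod_val[OF fin'] f n(3) transl_inject by (rule sym)
    then show "n' = n" by (rule val_inject[OF assms fin' n(1,2)])
  qed
qed

end

theorem theorem4p1:
  fixes A1 A2 A3 :: complex
  assumes "nondegenerate_triangle A1 A2 A3"
  shows "(typical_triangle A1 A2 A3 \<longrightarrow>
            translation_subgroup A1 A2 A3 =
              normal_closure (triangle_group A1 A2 A3) (t1 A1 A2 A3))
       \<and> (generic_triangle A1 A2 A3 \<longrightarrow>
            free_abelian_basis E2 (translation_subgroup A1 A2 A3)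
              (conj_class (triangle_group A1 A2 A3) (t1 A1 A2 A3)))"
proof -
  interpret triangle A1 A2 A3 by unfold_locales (rule assms)
  show ?thesis
    using T_eq_closure typical_independent free_abelian generic_laurent_free by blast
qed

end
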